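(* Let $a<b$ be finite and let $\mu,\tilde\mu\in\mathcal{P}(a,b)$. Let $\tilde g$ be a function saturating the classical Poincaré inequality for $\tilde\mu$ (that is, the weighted one with weight identically equal to $1$). Then the function $g$ defined by $$g(x)=\tilde g(x)-\int_a^b\tilde g(y)\,\mu(dy)$$ belongs to $\mathscr{C}^{1,2}_*(a,b)$ and satisfies $$g'(a)=g'(b)=0,\qquad g''(a)\neq0,\qquad g''(b)\neq 0.$$ Moreover, the function $$w_g(x)=-\frac{1}{g'(x)\rho(x)}\int_a^x g(y)\rho(y)\,dy,\quad x\in(a,b),$$ where $\rho$ is the density of $\mu$, extended to $[a,b]$ by its limits at $a$ and $b$, is a weight in $\mathcal{W}(a,b)$ that does not vanish on $[a,b]$, and $\mu$ satisfies a weighted Poincaré inequality with weight $w_g$.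
   Context: $\mathscr{C}^{0,1}_+(a,b)$: the set of functions that are continuous and piecewise $\mathscr{C}^1$ (piecewise continuously differentiable) on $[a,b]$ and positive on $(a,b)$. $\mathscr{C}^{1,2}_*(a,b)$: the set of functions $f$ such that $f'\in\mathscr{C}^{0,1}_+(a,b)$ or $-f'\in\mathscr{C}^{0,1}_+(a,b)$. Derivatives at the endpoints are one-sided. $\mathcal{P}(a,b)$ (for finite $a<b$): the set of probability measures on $[a,b]$ having a Lebesgue density $\rho\in\mathscr{C}^{0,1}_+(a,b)$ with $\rho(a)>0$ and $\rho(b)>0$. $\mathcal{W}(a,b)$ (weights): the set of continuous functions on $[a,b]$ that are piecewise $\mathscr{C}^1$ and positive on $(a,b)$. For $\mu\in\mathcal{P}(a,b)$ and $w\in\mathcal{W}(a,b)$, $H^1(\mu,w)=\{f\in L^2(\mu): w^{1/2}f'\in L^2(\mu)\}$, with $f'$ the weak derivative. $\mu$ satisfies a weighted Poincaré inequality with weight $w$ if there is a constant $C>0$ such that $$\int_a^b f^2\,d\mu\le C\int_a^b w\,(f')^2\,d\mu$$ for every $f\in H^1(\mu,w)$ with $\int_a^b f\,d\mu=0$. The Poincaré constant $C_P(\mu,w)$ is the smallest such $C$. A function saturating the inequality is a non-null $f\in H^1(\mu,w)$ with $\int_a^b f\,d\mu=0$ realizing equality with $C=C_P(\mu,w)$ (identified with its continuous representative); for $w\equiv1$ and finite $a,b$ it is unique up to a multiplicative constant. *)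

theory Defs
  imports "HOL-Analysis.Analysis" "HOL-Probability.Probability_Measure"
begin

(* All function classes on [a,b] are sets of functions real => real of which only the values on
   {a..b} matter.  Taking the derivative within {a..b} makes it one-sided at a and at b. *)

definition deriv_on :: "real \<Rightarrow> real \<Rightarrow> (real \<Rightarrow> real) \<Rightarrow> real \<Rightarrow> real" where
  "deriv_on a b f x = vector_derivative f (at x within {a..b})"

definition C1_on :: "real \<Rightarrow> real \<Rightarrow> (real \<Rightarrow> real) \<Rightarrow> bool" where
  "C1_on c d f \<longleftrightarrow> f differentiable_on {c..d} \<and> continuous_on {c..d} (deriv_on c d f)"

(* C^1 on every closed piece of a finite subdivision.  The library's piecewise_C1_differentiable_on
   is not used because it puts no condition on the derivative near the exceptional points: it
   admits, e.g., sqrt on {0..1}. *)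
definition piecewise_C1 :: "real \<Rightarrow> real \<Rightarrow> (real \<Rightarrow> real) \<Rightarrow> bool" where
  "piecewise_C1 a b f \<longleftrightarrow>
     (\<exists>(t :: nat \<Rightarrow> real) n. t 0 = a \<and> t n = b \<and>
        (\<forall>i<n. t i < t (Suc i) \<and> C1_on (t i) (t (Suc i)) f))"

definition C01_plus :: "real \<Rightarrow> real \<Rightarrow> (real \<Rightarrow> real) set" where
  "C01_plus a b = {f. continuous_on {a..b} f \<and> piecewise_C1 a b f \<and> (\<forall>x\<in>{a<..<b}. 0 < f x)}"

definition C12_star :: "real \<Rightarrow> real \<Rightarrow> (real \<Rightarrow> real) set" where
  "C12_star a b = {f. f differentiable_on {a..b} \<and>
     (deriv_on a b f \<in> C01_plus a b \<or> (\<lambda>x. - deriv_on a b f x) \<in> C01_plus a b)}"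

(* The density is determined everywhere on {a..b}, since it is continuous there. *)
definition has_density_on :: "real \<Rightarrow> real \<Rightarrow> real measure \<Rightarrow> (real \<Rightarrow> real) \<Rightarrow> bool" where
  "has_density_on a b \<mu> \<rho> \<longleftrightarrow>
     \<mu> = density (restrict_space lborel {a..b}) (\<lambda>x. ennreal (\<rho> x)) \<and>
     \<rho> \<in> C01_plus a b \<and> 0 < \<rho> a \<and> 0 < \<rho> b"

definition prob_class :: "real \<Rightarrow> real \<Rightarrow> real measure set" where
  "prob_class a b = {\<mu>. prob_space \<mu> \<and> (\<exists>\<rho>. has_density_on a b \<mu> \<rho>)}"

(* Piecewise C^1 up to the endpoints of [a,b]. *)
definition weights :: "real \<Rightarrow> real \<Rightarrow> (real \<Rightarrow> real) set" where
  "weights a b = {w. continuous_on {a..b} w \<and> piecewise_C1 a b w \<and> (\<forall>x\<in>{a<..<b}. 0 < w x)}"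

(* Functions rather than classes modulo equality almost everywhere. *)
definition L2 :: "real measure \<Rightarrow> (real \<Rightarrow> real) set" where
  "L2 \<mu> = {f \<in> borel_measurable \<mu>. integrable \<mu> (\<lambda>x. (f x)\<^sup>2)}"

definition locally_integrable :: "real \<Rightarrow> real \<Rightarrow> (real \<Rightarrow> real) \<Rightarrow> bool" where
  "locally_integrable a b f \<longleftrightarrow>
     (\<forall>c d. a < c \<and> c < d \<and> d < b \<longrightarrow> set_integrable lborel {c..d} f)"

definition test_function :: "real \<Rightarrow> real \<Rightarrow> (real \<Rightarrow> real) \<Rightarrow> bool" where
  "test_function a b \<phi> \<longleftrightarrow> \<phi> C1_differentiable_on UNIV \<and>
     (\<exists>c d. a < c \<and> c < d \<and> d < b \<and> (\<forall>x. x \<notin> {c..d} \<longrightarrow> \<phi> x = 0))"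

(* h is a weak derivative of f on (a,b); it is unique almost everywhere.  Test functions are C^1
   with compact support in (a,b), as in Brezis's definition of Sobolev spaces on an interval. *)
definition weak_deriv :: "real \<Rightarrow> real \<Rightarrow> (real \<Rightarrow> real) \<Rightarrow> (real \<Rightarrow> real) \<Rightarrow> bool" where
  "weak_deriv a b f h \<longleftrightarrow> locally_integrable a b f \<and> locally_integrable a b h \<and>
     (\<forall>\<phi>. test_function a b \<phi> \<longrightarrow>
        (LINT x:{a<..<b}|lborel. f x * deriv \<phi> x) = - (LINT x:{a<..<b}|lborel. h x * \<phi> x))"

definition H1 :: "real \<Rightarrow> real \<Rightarrow> real measure \<Rightarrow> (real \<Rightarrow> real) \<Rightarrow> (real \<Rightarrow> real) set" where
  "H1 a b \<mu> w = {f \<in> L2 \<mu>. \<exists>h. weak_deriv a b f h \<and> (\<lambda>x. sqrt (w x) * h x) \<in> L2 \<mu>}"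

definition poincare_with ::
  "real \<Rightarrow> real \<Rightarrow> real measure \<Rightarrow> (real \<Rightarrow> real) \<Rightarrow> real \<Rightarrow> bool" where
  "poincare_with a b \<mu> w C \<longleftrightarrow> 0 < C \<and>
     (\<forall>f\<in>H1 a b \<mu> w. \<forall>h. weak_deriv a b f h \<and> (\<integral>x. f x \<partial>\<mu>) = 0 \<longrightarrow>
        (\<integral>x. (f x)\<^sup>2 \<partial>\<mu>) \<le> C * (\<integral>x. w x * (h x)\<^sup>2 \<partial>\<mu>))"

definition weighted_poincare :: "real \<Rightarrow> real \<Rightarrow> real measure \<Rightarrow> (real \<Rightarrow> real) \<Rightarrow> bool" where
  "weighted_poincare a b \<mu> w \<longleftrightarrow> (\<exists>C. poincare_with a b \<mu> w C)"

definition is_poincare_constant ::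
  "real \<Rightarrow> real \<Rightarrow> real measure \<Rightarrow> (real \<Rightarrow> real) \<Rightarrow> real \<Rightarrow> bool" where
  "is_poincare_constant a b \<mu> w C \<longleftrightarrow>
     poincare_with a b \<mu> w C \<and> (\<forall>C'. poincare_with a b \<mu> w C' \<longrightarrow> C \<le> C')"

(* Continuity selects the continuous representative. *)
definition saturates :: "real \<Rightarrow> real \<Rightarrow> real measure \<Rightarrow> (real \<Rightarrow> real) \<Rightarrow> (real \<Rightarrow> real) \<Rightarrow> bool" where
  "saturates a b \<mu> w f \<longleftrightarrow>
     f \<in> H1 a b \<mu> w \<and> continuous_on {a..b} f \<and> \<not> (AE x in \<mu>. f x = 0) \<and> (\<integral>x. f x \<partial>\<mu>) = 0 \<and>
     (\<exists>C h. is_poincare_constant a b \<mu> w C \<and> weak_deriv a b f h \<and>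
        (\<integral>x. (f x)\<^sup>2 \<partial>\<mu>) = C * (\<integral>x. w x * (h x)\<^sup>2 \<partial>\<mu>))"

definition weight_interior ::
  "real \<Rightarrow> real \<Rightarrow> (real \<Rightarrow> real) \<Rightarrow> (real \<Rightarrow> real) \<Rightarrow> real \<Rightarrow> real" where
  "weight_interior a b \<rho> g x =
     - (1 / (deriv_on a b g x * \<rho> x)) * (LINT y:{a..x}|lborel. g y * \<rho> y)"

(* If this function is continuous on {a..b}, then in particular both one-sided limits exist. *)
definition weight_of ::
  "real \<Rightarrow> real \<Rightarrow> (real \<Rightarrow> real) \<Rightarrow> (real \<Rightarrow> real) \<Rightarrow> real \<Rightarrow> real" where
  "weight_of a b \<rho> g x =
     (if x \<le> a then Lim (at_right a) (weight_interior a b \<rho> g)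
      else if b \<le> x then Lim (at_left b) (weight_interior a b \<rho> g)
      else weight_interior a b \<rho> g x)"

end

theory Submission
  imports Defs
begin

text \<open>Let \<open>\<tau>\<close> be the density of \<open>\<mu>t\<close>, \<open>C\<close> its Poincare constant and \<open>G x = \<integral>\<^sub>a\<^sup>x gt \<tau>\<close>. Stationarity of the
  variance quotient at \<open>gt\<close>, tested with \<open>u' = \<phi> / \<tau>\<close>, turns into \<open>gt' = - G / (C \<tau>)\<close> by the
  du Bois-Reymond lemma for continuous functions; in particular \<open>gt'\<close> vanishes at both endpoints.
  If \<open>G\<close> vanished at an interior point \<open>c\<close>, then a competitor that is constant beyond \<open>c\<close> would
  force \<open>gt c = 0\<close>, and uniqueness for the linear system in \<open>(gt, G)\<close> would give \<open>gt = 0\<close>. Hence \<open>gt\<close>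
  and \<open>g\<close> are strictly monotone with mean zero for their respective measures, so that with
  \<open>\<Gamma> x = \<integral>\<^sub>a\<^sup>x g \<rho>\<close> the weight \<open>C (\<tau> / \<rho>) (\<Gamma> / G)\<close> is positive up to the endpoints. A weight bounded
  away from zero inherits a Poincare inequality from the one of \<open>\<mu>t\<close>, because all
  the densities involved are bounded above and away from zero.\<close>

section \<open>Piecewise continuously differentiable functions\<close>

text \<open>The slope \<open>\<phi> / \<tau>\<close> of the test function makes the density cancel
  in the integral of \<open>h u'\<close> against \<open>\<mu>t\<close>, where \<open>h\<close> is
  the weak derivative of \<open>gt\<close>. What remains is the pairing of \<open>h\<close> with
  \<open>\<phi>\<close>, which the definition of a weak derivative moves onto \<open>gt\<close>. The
  formula for the weight comes from substituting \<open>g' = gt' = - G / (C \<tau>)\<close> into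
  \<open>w_g\<close>: \<open>g\<close> and \<open>gt\<close> differ by a constant, although their
  means vanish for different measures. The obstacle is the behaviour at an endpoint
  \<open>e\<close>, where \<open>\<Gamma> / G\<close> has the form 0/0. A strictly monotone function
  of mean zero is nonzero at both endpoints, so \<open>\<Gamma>\<close> and \<open>G\<close> have
  simple zeros there. Dividing both by \<open>x - e\<close> gives the limit
  \<open>C * g e / gt e\<close> of the weight, and also its \<open>C^1\<close> regularity up to
  \<open>e\<close>, which a limit alone would not provide. The same fact gives the second
  derivative: \<open>g'' e = - gt e / C\<close>.\<close>

lemma C1_on_iff:
  assumes "c < d"
  shows "C1_on c d f \<longleftrightarrow>
    (\<exists>f'. (\<forall>x\<in>{c..d}. (f has_real_derivative f' x) (at x within {c..d})) \<and> continuous_on {c..d} f')"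
proof
  assume "C1_on c d f"
  then have "f differentiable_on {c..d}" and c: "continuous_on {c..d} (deriv_on c d f)"
    by (auto simp: C1_on_def)
  then have "(f has_real_derivative deriv_on c d f x) (at x within {c..d})" if "x \<in> {c..d}" for x
    using that unfolding deriv_on_def has_real_derivative_iff_has_vector_derivative
    by (auto simp: differentiable_on_def vector_derivative_works)
  with c show "\<exists>f'. (\<forall>x\<in>{c..d}. (f has_real_derivative f' x) (at x within {c..d})) \<and> continuous_on {c..d} f'"
    by blast
next
  assume "\<exists>f'. (\<forall>x\<in>{c..d}. (f has_real_derivative f' x) (at x within {c..d})) \<and> continuous_on {c..d} f'"
  then obtain f' where f': "\<And>x. x \<in> {c..d} \<Longrightarrow> (f has_real_derivative f' x) (at x within {c..d})"
    and c: "continuous_on {c..d} f'" by blast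
  \<comment> \<open>One-sided derivatives are unique because \<open>c < d\<close>, so any witness
    \<open>f'\<close> agrees with the derivative that \<open>deriv_on\<close> selects.\<close>
  have "deriv_on c d f x = f' x" if "x \<in> {c..d}" for x
    unfolding deriv_on_def using assms that
      f'[OF that, unfolded has_real_derivative_iff_has_vector_derivative]
    by (rule vector_derivative_within_closed_interval)
  then have "continuous_on {c..d} (deriv_on c d f)"
    by (subst continuous_on_cong[OF refl, of _ _ f']) (use c in simp_all)
  moreover have "f differentiable_on {c..d}"
    using f' by (meson differentiable_on_def real_differentiable_def)
  ultimately show "C1_on c d f" by (simp add: C1_on_def)
qed

lemma C1_onE:
  assumes "C1_on c d f" "c < d"
  obtains f' where "\<And>x. x \<in> {c..d} \<Longrightarrow> (f has_real_derivative f' x) (at x within {c..d})"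
    "continuous_on {c..d} f'"
  using assms by (force simp: C1_on_iff simp del: atLeastAtMost_iff)

lemma deriv_on_eq:
  assumes "a < b" "x \<in> {a..b}" "(f has_real_derivative D) (at x within {a..b})"
  shows "deriv_on a b f x = D"
  unfolding deriv_on_def using assms(1,2) assms(3)[unfolded has_real_derivative_iff_has_vector_derivative]
  by (rule vector_derivative_within_closed_interval)

lemma C1_on_cong:
  assumes "c < d" "\<And>x. x \<in> {c..d} \<Longrightarrow> f x = g x" "C1_on c d f"
  shows "C1_on c d g"
proof -
  obtain f' where f': "\<And>x. x \<in> {c..d} \<Longrightarrow> (f has_real_derivative f' x) (at x within {c..d})"
    and c: "continuous_on {c..d} f'" using C1_onE[OF assms(3,1)] by blast
  have "(g has_real_derivative f' x) (at x within {c..d})" if "x \<in> {c..d}" for x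
    by (rule has_field_derivative_transform_within[OF f'[OF that] zero_less_one that])
       (use assms(2) in auto)
  with c show ?thesis unfolding C1_on_iff[OF assms(1)] by blast
qed

lemma C1_on_subset:
  assumes "C1_on a b f" "a \<le> c" "c < d" "d \<le> b"
  shows "C1_on c d f"
proof -
  have "a < b" using assms by linarith
  then obtain f' where f': "\<And>x. x \<in> {a..b} \<Longrightarrow> (f has_real_derivative f' x) (at x within {a..b})"
    and c: "continuous_on {a..b} f'" using C1_onE[OF assms(1)] by blast
  have "{c..d} \<subseteq> {a..b}" using assms by auto
  then show ?thesis using f' c assms(3)
    unfolding C1_on_iff[OF assms(3)]
    by (meson DERIV_subset continuous_on_subset subsetD)
qed

lemma C1_on_imp_continuous_on:
  assumes "C1_on c d f" shows "continuous_on {c..d} f"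
  using assms by (auto simp: C1_on_def intro: differentiable_imp_continuous_on)

lemma C1_on_mult:
  assumes "c < d" "C1_on c d f" "C1_on c d g"
  shows "C1_on c d (\<lambda>x. f x * g x)"
proof -
  obtain f' where f': "\<And>x. x \<in> {c..d} \<Longrightarrow> (f has_real_derivative f' x) (at x within {c..d})"
      "continuous_on {c..d} f'"
    using C1_onE[OF assms(2,1)] by blast
  obtain g' where g': "\<And>x. x \<in> {c..d} \<Longrightarrow> (g has_real_derivative g' x) (at x within {c..d})"
      "continuous_on {c..d} g'"
    using C1_onE[OF assms(3,1)] by blast
  note [continuous_intros] = C1_on_imp_continuous_on[OF assms(2)] C1_on_imp_continuous_on[OF assms(3)]
  show ?thesis unfolding C1_on_iff[OF assms(1)]
    by (rule exI[of _ "\<lambda>x. f' x * g x + g' x * f x"])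
       (auto intro!: DERIV_mult f' g' continuous_intros)
qed

lemma C1_on_divide:
  assumes "c < d" "C1_on c d f" "C1_on c d g" "\<And>x. x \<in> {c..d} \<Longrightarrow> g x \<noteq> 0"
  shows "C1_on c d (\<lambda>x. f x / g x)"
proof -
  obtain f' where f': "\<And>x. x \<in> {c..d} \<Longrightarrow> (f has_real_derivative f' x) (at x within {c..d})"
      "continuous_on {c..d} f'"
    using C1_onE[OF assms(2,1)] by blast
  obtain g' where g': "\<And>x. x \<in> {c..d} \<Longrightarrow> (g has_real_derivative g' x) (at x within {c..d})"
      "continuous_on {c..d} g'"
    using C1_onE[OF assms(3,1)] by blast
  note [continuous_intros] = C1_on_imp_continuous_on[OF assms(2)] C1_on_imp_continuous_on[OF assms(3)]
  show ?thesis unfolding C1_on_iff[OF assms(1)]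
    by (rule exI[of _ "\<lambda>x. (f' x * g x - f x * g' x) / (g x * g x)"])
       (use assms(4) in \<open>auto intro!: DERIV_divide f' g' continuous_intros\<close>)
qed

lemma C1_on_const: "c < d \<Longrightarrow> C1_on c d (\<lambda>_. k)"
  by (auto simp: C1_on_iff intro!: exI[of _ "\<lambda>_. 0"])

lemma C1_onI:
  assumes "c < d" "\<And>x. x \<in> {c..d} \<Longrightarrow> (f has_real_derivative f' x) (at x within {c..d})"
    "continuous_on {c..d} f'"
  shows "C1_on c d f"
  using assms(2,3) unfolding C1_on_iff[OF assms(1)] by blast

text \<open>The difference quotient is the average of the derivative,
  \<open>F x / (x - e) = \<integral>\<^sub>0\<^sup>1 p (e + s (x - e)) ds\<close>, which can be differentiated under the integral.\<close>

lemma C1_on_difference_quotient: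
  fixes F p :: "real \<Rightarrow> real"
  assumes "c < d" "e \<in> {c..d}" "F e = 0" "C1_on c d p"
    and F: "\<And>x. x \<in> {c..d} \<Longrightarrow> (F has_real_derivative p x) (at x within {c..d})"
  shows "C1_on c d (\<lambda>x. if x = e then p e else F x / (x - e))"
proof -
  obtain p' where
    p': "\<And>x. x \<in> {c..d} \<Longrightarrow> (p has_real_derivative p' x) (at x within {c..d})" "continuous_on {c..d} p'"
    using C1_onE[OF assms(4,1)] by blast
  have cp: "continuous_on {c..d} p" using C1_on_imp_continuous_on assms(4) by blast
  have in_seg: "e + s * (x - e) \<in> {c..d}" if "x \<in> {c..d}" "s \<in> {0..1}" for x s
  proof -
    have "(1 - s) *\<^sub>R e + s *\<^sub>R x \<in> {c..d}"
      using convexD_alt[OF convex_real_interval(5), of e c d x s] assms(2) that by auto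
    then show ?thesis by (simp add: algebra_simps)
  qed
  define A where "A x = integral {0..1} (\<lambda>s. p (e + s * (x - e)))" for x
  define A' where "A' x = integral {0..1} (\<lambda>s. s * p' (e + s * (x - e)))" for x
  have A: "(A has_real_derivative A' x) (at x within {c..d})" if x: "x \<in> {c..d}" for x
    unfolding A_def A'_def
  proof (rule leibniz_rule_field_derivative[where a=0 and b="1::real", simplified cbox_interval])
    fix x t :: real assume "x \<in> {c..d}" "t \<in> {0..1}"
    have "((\<lambda>x. e + t * (x - e)) has_real_derivative t) (at x within {c..d})"
      by (auto intro!: derivative_eq_intros)
    moreover have "(\<lambda>x. e + t * (x - e)) ` {c..d} \<subseteq> {c..d}"
      using in_seg \<open>t \<in> {0..1}\<close> by blast
    then have "(p has_real_derivative p' (e + t * (x - e)))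
        (at (e + t * (x - e)) within (\<lambda>x. e + t * (x - e)) ` {c..d})"
      using p'(1)[OF in_seg[OF \<open>x \<in> {c..d}\<close> \<open>t \<in> {0..1}\<close>]] DERIV_subset by blast
    ultimately have "(p \<circ> (\<lambda>x. e + t * (x - e)) has_real_derivative p' (e + t * (x - e)) * t)
        (at x within {c..d})"
      by (rule DERIV_image_chain[rotated])
    then show "((\<lambda>x. p (e + t * (x - e))) has_real_derivative t * p' (e + t * (x - e))) (at x within {c..d})"
      by (simp add: o_def mult.commute)
  next
    fix x assume "x \<in> {c..d}"
    then show "(\<lambda>s. p (e + s * (x - e))) integrable_on {0..1}"
      using in_seg
      by (intro integrable_continuous_real continuous_on_compose2[OF cp] continuous_intros) auto
  next
    show "continuous_on ({c..d} \<times> {0..1}) (\<lambda>(x, s). s * p' (e + s * (x - e)))"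
      unfolding case_prod_beta using in_seg
      by (intro continuous_intros continuous_on_compose2[OF p'(2)]) auto
  qed (use x in auto)
  have cA': "continuous_on {c..d} A'"
    unfolding A'_def
  proof (rule integral_continuous_on_param[where a=0 and b="1::real", simplified cbox_interval])
    show "continuous_on ({c..d} \<times> {0..1}) (\<lambda>(x, s). s * p' (e + s * (x - e)))"
      unfolding case_prod_beta using in_seg
      by (intro continuous_intros continuous_on_compose2[OF p'(2)]) auto
  qed
  have "A x = (if x = e then p e else F x / (x - e))" if x: "x \<in> {c..d}" for x
  proof (cases "x = e")
    case False
    have "((\<lambda>s. p (e + s * (x - e)) * (x - e)) has_integral F (e + 1 * (x - e)) - F (e + 0 * (x - e))) {0..1}"
    proof (rule fundamental_theorem_of_calculus)
      fix s :: real assume s: "s \<in> {0..1}"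
      have "((\<lambda>s. e + s * (x - e)) has_real_derivative (x - e)) (at s within {0..1})"
        by (auto intro!: derivative_eq_intros)
      moreover have "(\<lambda>s. e + s * (x - e)) ` {0..1} \<subseteq> {c..d}" using in_seg x by blast
      then have "(F has_real_derivative p (e + s * (x - e)))
          (at (e + s * (x - e)) within (\<lambda>s. e + s * (x - e)) ` {0..1})"
        using F[OF in_seg[OF x s]] DERIV_subset by blast
      ultimately have "(F \<circ> (\<lambda>s. e + s * (x - e)) has_real_derivative p (e + s * (x - e)) * (x - e))
        (at s within {0..1})"
        by (rule DERIV_image_chain[rotated])
      then show "((\<lambda>s. F (e + s * (x - e))) has_vector_derivative p (e + s * (x - e)) * (x - e)) (at s within {0..1})"
        by (simp add: o_def has_real_derivative_iff_has_vector_derivative)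
    qed simp
    then have "integral {0..1} (\<lambda>s. p (e + s * (x - e)) * (x - e)) = F x"
      using assms(3) by (subst integral_unique) auto
    then have "A x * (x - e) = F x" by (simp add: A_def)
    then show ?thesis using False by (simp add: field_simps)
  qed (simp add: A_def)
  moreover have "C1_on c d A" using A cA' C1_onI assms(1) by blast
  ultimately show ?thesis by (rule C1_on_cong[OF assms(1)])
qed

text \<open>With a finite exceptional set in place of an ordered list of nodes, a common refinement
  is just a union. The condition concerns the open interval only, so a piece may end at exceptional
  points and is still \<open>C^1\<close> up to them.\<close>

lemma piecewise_C1_altdef:
  "piecewise_C1 a b f \<longleftrightarrow> a \<le> b \<and> (\<exists>S. finite S \<and>
     (\<forall>c d. a \<le> c \<and> c < d \<and> d \<le> b \<and> {c<..<d} \<inter> S = {} \<longrightarrow> C1_on c d f))"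
proof
  assume "piecewise_C1 a b f"
  then obtain t :: "nat \<Rightarrow> real" and n where t: "t 0 = a" "t n = b"
    "\<And>i. i < n \<Longrightarrow> t i < t (Suc i)" "\<And>i. i < n \<Longrightarrow> C1_on (t i) (t (Suc i)) f"
    by (auto simp: piecewise_C1_def)
  have inc: "i \<le> j \<Longrightarrow> j \<le> n \<Longrightarrow> t i \<le> t j" for i j
  proof (induction j)
    case (Suc j) then show ?case using t(3)[of j] by (cases "i = Suc j") auto
  qed simp
  have "C1_on c d f" if "a \<le> c" "c < d" "d \<le> b" "{c<..<d} \<inter> t ` {..n} = {}" for c d
  proof -
    \<comment> \<open>The last node that is not to the right of \<open>c\<close>. As no node lies
      strictly between \<open>c\<close> and \<open>d\<close>, the next one is at or beyond
      \<open>d\<close>.\<close>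
    define i where "i = (GREATEST i. i \<le> n \<and> t i \<le> c)"
    have ex: "0 \<le> n \<and> t 0 \<le> c" using t that by simp
    have i: "i \<le> n \<and> t i \<le> c" unfolding i_def using ex by (rule GreatestI_nat[of "\<lambda>i. i \<le> n \<and> t i \<le> c" 0 n]) auto
    have "i \<noteq> n" using i t that by auto
    with i have "i < n" by simp
    have "\<not> (Suc i \<le> n \<and> t (Suc i) \<le> c)"
    proof
      assume "Suc i \<le> n \<and> t (Suc i) \<le> c"
      then have "Suc i \<le> i" unfolding i_def by (rule Greatest_le_nat[of _ _ n]) auto
      then show False by simp
    qed
    with \<open>i < n\<close> have "c < t (Suc i)" by auto
    moreover have "t (Suc i) \<notin> {c<..<d}" using that(4) \<open>i < n\<close> by auto
    ultimately have "d \<le> t (Suc i)" by auto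
    with i t(4)[OF \<open>i < n\<close>] \<open>c < d\<close> show ?thesis by (meson C1_on_subset)
  qed
  moreover have "a \<le> b" using inc[of 0 n] t by simp
  ultimately show "a \<le> b \<and> (\<exists>S. finite S \<and>
     (\<forall>c d. a \<le> c \<and> c < d \<and> d \<le> b \<and> {c<..<d} \<inter> S = {} \<longrightarrow> C1_on c d f))"
    by (intro conjI exI[of _ "t ` {..n}"]) auto
next
  assume "a \<le> b \<and> (\<exists>S. finite S \<and>
     (\<forall>c d. a \<le> c \<and> c < d \<and> d \<le> b \<and> {c<..<d} \<inter> S = {} \<longrightarrow> C1_on c d f))"
  then obtain S where "finite S" "a \<le> b" and
    S: "\<And>c d. a \<le> c \<Longrightarrow> c < d \<Longrightarrow> d \<le> b \<Longrightarrow> {c<..<d} \<inter> S = {} \<Longrightarrow> C1_on c d f"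
    by blast
  \<comment> \<open>Adding \<open>a\<close> and \<open>b\<close> and discarding what lies outside
    makes the sorted list run exactly from \<open>a\<close> to \<open>b\<close>. If
    \<open>a = b\<close>, it has a single entry and there are no pieces.\<close>
  define T where "T = insert a (insert b (S \<inter> {a..b}))"
  define l where "l = sorted_list_of_set T"
  have T: "finite T" "T \<subseteq> {a..b}" "a \<in> T" "b \<in> T"
    using \<open>finite S\<close> \<open>a \<le> b\<close> by (auto simp: T_def)
  have l: "set l = T" "sorted_wrt (<) l" using T by (auto simp: l_def)
  define n where "n = length l - 1"
  have len: "length l = Suc n" using l T by (cases l) (auto simp: n_def)
  have mono: "l ! i < l ! j" if "i < j" "j \<le> n" for i j
    using l(2) that len by (auto simp: sorted_wrt_iff_nth_less)
  have mono': "l ! i \<le> l ! j" if "i \<le> j" "j \<le> n" for i j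
    using mono[of i j] that by (cases "i = j") auto
  have nth: "l ! i \<in> T" if "i \<le> n" for i using that len l by (metis le_imp_less_Suc nth_mem)
  have ex: "\<exists>i\<le>n. l ! i = x" if "x \<in> T" for x
    using that l(1) len by (metis in_set_conv_nth less_Suc_eq_le)
  have "l ! 0 = a"
  proof -
    obtain i where "i \<le> n" "l ! i = a" using ex T by blast
    then show ?thesis using mono'[of 0 i] nth[of 0] T by force
  qed
  moreover have "l ! n = b"
  proof -
    obtain i where "i \<le> n" "l ! i = b" using ex T by blast
    then show ?thesis using mono'[of i n] nth[of n] T by force
  qed
  moreover have "l ! i < l ! Suc i \<and> C1_on (l ! i) (l ! Suc i) f" if "i < n" for i
  proof
    show lt: "l ! i < l ! Suc i" using mono that by simp
    have "x \<notin> S" if "x \<in> {l ! i<..<l ! Suc i}" for x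
    proof
      assume "x \<in> S"
      moreover have "x \<in> {a..b}" using that nth[of i] nth[of "Suc i"] T \<open>i < n\<close> by force
      ultimately have "x \<in> T" by (simp add: T_def)
      then obtain j where j: "j \<le> n" "l ! j = x" using ex by blast
      show False
        using mono'[of j i] mono'[of "Suc i" j] that j \<open>i < n\<close> by (cases "j \<le> i") auto
    qed
    then show "C1_on (l ! i) (l ! Suc i) f"
      using nth[of i] nth[of "Suc i"] T \<open>i < n\<close> lt by (intro S) (force+)
  qed
  ultimately show "piecewise_C1 a b f"
    unfolding piecewise_C1_def by (intro exI[of _ "\<lambda>i. l ! i"] exI[of _ n]) auto
qed

section \<open>Weak derivatives and integrals against a density\<close>

lemma set_integral_Ioo_eq_Icc:
  fixes f :: "real \<Rightarrow> real"
  shows "(LINT x:{a<..<b}|lborel. f x) = (LINT x:{a..b}|lborel. f x)"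
  by (rule set_integral_discrete_difference[where X="{a, b}"]) auto

lemma set_integral_Icc_continuous:
  fixes f :: "real \<Rightarrow> real"
  assumes "continuous_on {a..b} f"
  shows "(LINT x:{a..b}|lborel. f x) = integral {a..b} f"
  using set_borel_integral_eq_integral(2)[OF borel_integrable_atLeastAtMost'[OF assms]] .

lemma locally_integrable_continuous:
  assumes "continuous_on {a..b} f" shows "locally_integrable a b f"
  unfolding locally_integrable_def
proof (intro allI impI)
  fix c d assume "a < c \<and> c < d \<and> d < b"
  then have "{c..d} \<subseteq> {a..b}" by auto
  then show "set_integrable lborel {c..d} f"
    using borel_integrable_atLeastAtMost'[OF assms] by (rule set_integrable_subset[rotated 2]) auto
qed

text \<open>Local integrability controls only compact subintervals of the open interval. The
  restrictions to an exhausting sequence are measurable, hence so is their pointwise limit, and the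
  two endpoints are added as single-point terms.\<close>

lemma locally_integrable_measurable:
  fixes f :: "real \<Rightarrow> real"
  assumes "a < b" "locally_integrable a b f"
  shows "f \<in> borel_measurable (restrict_space lborel {a..b})"
proof -
  \<comment> \<open>The shift by 2 keeps \<open>e n\<close> at most a third of \<open>b - a\<close>,
    so that \<open>{a + e n..b - e n}\<close> is never degenerate.\<close>
  define e where "e n = (b - a) * inverse (real (Suc (n + 2)))" for n
  have e: "0 < e n" "a + e n < b - e n" for n
  proof -
    show "0 < e n" using assms(1) by (simp add: e_def)
    have "(b - a) * inverse (real (Suc (n + 2))) < (b - a) * (1 / 2)"
      using assms(1) by (intro mult_strict_left_mono) (auto simp: inverse_eq_divide)
    then show "a + e n < b - e n" by (simp add: e_def)
  qed
  have e0: "e \<longlonglongrightarrow> 0"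
    unfolding e_def
    by (rule tendsto_mult_right_zero[OF LIMSEQ_ignore_initial_segment[OF LIMSEQ_inverse_real_of_nat]])
  define F where "F n x = indicator {a + e n..b - e n} x * f x" for n x
  have F: "F n \<in> borel_measurable lborel" for n
  proof -
    have "set_integrable lborel {a + e n..b - e n} f"
      using assms(2) e[of n] by (auto simp: locally_integrable_def)
    then show ?thesis unfolding set_integrable_def F_def by (auto dest: borel_measurable_integrable)
  qed
  have "(\<lambda>x. indicator {a<..<b} x * f x) \<in> borel_measurable lborel"
  proof (rule borel_measurable_LIMSEQ_real[OF _ F])
    fix x :: real
    show "(\<lambda>n. F n x) \<longlonglongrightarrow> indicator {a<..<b} x * f x"
    proof (cases "x \<in> {a<..<b}")
      case True
      then have "0 < min (x - a) (b - x)" by auto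
      then have "\<forall>\<^sub>F n in sequentially. e n < min (x - a) (b - x)"
        using order_tendstoD(2)[OF e0] by blast
      then have "\<forall>\<^sub>F n in sequentially. F n x = indicator {a<..<b} x * f x"
        by eventually_elim (use True in \<open>auto simp: F_def indicator_def\<close>)
      then show ?thesis by (rule tendsto_eventually)
    next
      case False
      then have "F n x = 0" for n using e[of n] by (auto simp: F_def indicator_def)
      with False show ?thesis by simp
    qed
  qed
  then have "(\<lambda>x. indicator {a<..<b} x * f x + (indicator {a} x * f a + indicator {b} x * f b))
      \<in> borel_measurable lborel"
    by measurable
  also have "(\<lambda>x. indicator {a<..<b} x * f x + (indicator {a} x * f a + indicator {b} x * f b))
      = (\<lambda>x. indicator {a..b} x *\<^sub>R f x)"
    using assms(1) by (auto simp: indicator_def fun_eq_iff)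
  finally show ?thesis by (subst borel_measurable_restrict_space_iff) auto
qed

lemma test_functionE:
  assumes "test_function a b \<phi>"
  obtains c d where "a < c" "c < d" "d < b" "\<And>x. x \<notin> {c..d} \<Longrightarrow> \<phi> x = 0"
    "\<And>x. x \<notin> {c..d} \<Longrightarrow> deriv \<phi> x = 0" "\<And>x. (\<phi> has_real_derivative deriv \<phi> x) (at x)"
    "continuous_on UNIV (deriv \<phi>)" "continuous_on UNIV \<phi>"
proof -
  obtain D where D: "\<And>x. (\<phi> has_real_derivative D x) (at x)" "continuous_on UNIV D"
    using assms
    by (auto simp: test_function_def C1_differentiable_on_def has_real_derivative_iff_has_vector_derivative)
  have "deriv \<phi> = D" using D DERIV_imp_deriv by blast
  obtain c d where cd: "a < c" "c < d" "d < b" "\<And>x. x \<notin> {c..d} \<Longrightarrow> \<phi> x = 0"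
    using assms by (auto simp: test_function_def)
  have "D x = 0" if "x \<notin> {c..d}" for x
  proof -
    have "open (- {c..d})" by (simp add: open_Compl)
    then have "(\<phi> has_real_derivative 0) (at x)"
      by (rule has_field_derivative_transform_within_open[OF DERIV_const[of 0]]) (use cd(4) that in auto)
    with D(1) show ?thesis using DERIV_unique by blast
  qed
  moreover have "continuous_on UNIV \<phi>" using D(1) DERIV_continuous_on by blast
  ultimately show thesis using that[OF cd] D \<open>deriv \<phi> = D\<close> by simp
qed

text \<open>The factor \<open>k\<close> is bounded and confines the product to a compact part of the
  open interval. With \<open>k\<close> a test function or its derivative, this allows the integrals
  in \<open>weak_deriv\<close> to be split.\<close>

lemma locally_integrable_mult:
  assumes f: "locally_integrable a b f" and cd: "a < c" "c < d" "d < b"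
    and k: "continuous_on UNIV k" "\<And>x. x \<notin> {c..d} \<Longrightarrow> k x = 0"
  shows "set_integrable lborel {a<..<b} (\<lambda>x. f x * k x)"
proof -
  have I: "integrable lborel (\<lambda>x. indicator {c..d} x * f x)"
    using f cd by (auto simp: locally_integrable_def set_integrable_def)
  have "compact (k ` {c..d})"
    using k(1) by (intro compact_continuous_image) (auto intro: continuous_on_subset)
  then obtain B where B: "\<And>x. x \<in> {c..d} \<Longrightarrow> \<bar>k x\<bar> \<le> B"
    using compact_imp_bounded bounded_iff by (metis imageI real_norm_def)
  have km: "k \<in> borel_measurable lborel" using k(1) by (simp add: borel_measurable_continuous_onI)
  have "integrable lborel (\<lambda>x. k x * (indicator {c..d} x * f x))"
  proof (rule Bochner_Integration.integrable_bound)
    show "integrable lborel (\<lambda>x. B * (indicator {c..d} x * f x))" using I by simp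
    show "(\<lambda>x. k x * (indicator {c..d} x * f x)) \<in> borel_measurable lborel"
      using I km by (auto dest: borel_measurable_integrable)
    have "norm (k x * (indicator {c..d} x * f x)) \<le> norm (B * (indicator {c..d} x * f x))" for x
    proof (cases "x \<in> {c..d}")
      case True
      then have "\<bar>k x\<bar> \<le> \<bar>B\<bar>" using B by force
      with True show ?thesis by (auto simp: abs_mult intro!: mult_right_mono)
    qed simp
    then show "AE x in lborel. norm (k x * (indicator {c..d} x * f x)) \<le> norm (B * (indicator {c..d} x * f x))"
      by simp
  qed
  moreover have "(\<lambda>x. k x * (indicator {c..d} x * f x)) = (\<lambda>x. indicator {a<..<b} x *\<^sub>R (f x * k x))"
    using k(2) cd by (auto simp: indicator_def fun_eq_iff)
  ultimately show ?thesis by (simp add: set_integrable_def)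
qed

lemma weak_deriv_add_mult:
  assumes fh: "weak_deriv a b f h" and fh2: "weak_deriv a b f2 h2"
  shows "weak_deriv a b (\<lambda>x. f x + t * f2 x) (\<lambda>x. h x + t * h2 x)"
proof -
  have loc: "locally_integrable a b (\<lambda>x. u x + t * v x)"
    if "locally_integrable a b u" "locally_integrable a b v" for u v
    using that by (auto simp: locally_integrable_def intro!: set_integral_add)
  have add: "(LINT x:{a<..<b}|lborel. (u x + t * v x) * k x) =
     (LINT x:{a<..<b}|lborel. u x * k x) + t * (LINT x:{a<..<b}|lborel. v x * k x)"
    if "set_integrable lborel {a<..<b} (\<lambda>x. u x * k x)"
       "set_integrable lborel {a<..<b} (\<lambda>x. v x * k x)" for u v k :: "real \<Rightarrow> real"
  proof -
    have "(LINT x:{a<..<b}|lborel. (u x + t * v x) * k x) =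
      (LINT x:{a<..<b}|lborel. u x * k x + t * (v x * k x))"
      by (simp add: algebra_simps)
    also have "\<dots> = (LINT x:{a<..<b}|lborel. u x * k x) + (LINT x:{a<..<b}|lborel. t * (v x * k x))"
      using that by (intro set_integral_add) auto
    finally show ?thesis by simp
  qed
  show ?thesis unfolding weak_deriv_def
  proof (intro conjI allI impI)
    fix \<phi> assume "test_function a b \<phi>"
    moreover from this obtain c d where cd: "a < c" "c < d" "d < b" "\<And>x. x \<notin> {c..d} \<Longrightarrow> \<phi> x = 0"
      "\<And>x. x \<notin> {c..d} \<Longrightarrow> deriv \<phi> x = 0" "continuous_on UNIV (deriv \<phi>)" "continuous_on UNIV \<phi>"
      by (rule test_functionE) blast
    ultimately show "(LINT x:{a<..<b}|lborel. (f x + t * f2 x) * deriv \<phi> x) =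
       - (LINT x:{a<..<b}|lborel. (h x + t * h2 x) * \<phi> x)"
      using fh fh2 locally_integrable_mult[OF _ cd(1-3,6,5)] locally_integrable_mult[OF _ cd(1-3,7,4)]
      by (auto simp: weak_deriv_def add)
  qed (use assms loc in \<open>auto simp: weak_deriv_def\<close>)
qed

text \<open>Integration by parts, without boundary terms because a test function vanishes at both
  endpoints. The smooth competitors and perturbations of the variational argument become admissible
  this way.\<close>

lemma weak_deriv_classical:
  assumes "a < b" and f: "\<And>x. x \<in> {a..b} \<Longrightarrow> (f has_real_derivative h x) (at x within {a..b})"
    and h: "continuous_on {a..b} h"
  shows "weak_deriv a b f h"
  unfolding weak_deriv_def
proof (intro conjI allI impI)
  have cf: "continuous_on {a..b} f" using f DERIV_continuous_on by blast
  then show "locally_integrable a b f" "locally_integrable a b h"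
    using h locally_integrable_continuous by auto
  fix \<phi> assume "test_function a b \<phi>"
  then obtain c d where cd: "a < c" "c < d" "d < b" "\<And>x. x \<notin> {c..d} \<Longrightarrow> \<phi> x = 0"
      "\<And>x. (\<phi> has_real_derivative deriv \<phi> x) (at x)"
      "continuous_on UNIV (deriv \<phi>)" "continuous_on UNIV \<phi>"
    by (rule test_functionE) blast
  have [continuous_intros]: "continuous_on {a..b} (deriv \<phi>)" "continuous_on {a..b} \<phi>"
    using cd continuous_on_subset by blast+
  note [continuous_intros] = cf h
  have "((\<lambda>x. f x * deriv \<phi> x + h x * \<phi> x) has_integral f b * \<phi> b - f a * \<phi> a) {a..b}"
  proof (rule fundamental_theorem_of_calculus)
    fix x assume "x \<in> {a..b}"
    then show "((\<lambda>x. f x * \<phi> x) has_vector_derivative f x * deriv \<phi> x + h x * \<phi> x) (at x within {a..b})"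
      unfolding has_real_derivative_iff_has_vector_derivative[symmetric]
      using DERIV_mult[OF f has_field_derivative_at_within[OF cd(5)]]
      by (simp add: algebra_simps)
  qed (use \<open>a < b\<close> in simp)
  moreover have "\<phi> a = 0" "\<phi> b = 0" using cd by auto
  ultimately have "integral {a..b} (\<lambda>x. f x * deriv \<phi> x + h x * \<phi> x) = 0"
    by (simp add: integral_unique)
  moreover have "integral {a..b} (\<lambda>x. f x * deriv \<phi> x + h x * \<phi> x) =
    integral {a..b} (\<lambda>x. f x * deriv \<phi> x) + integral {a..b} (\<lambda>x. h x * \<phi> x)"
    by (intro Henstock_Kurzweil_Integration.integral_add integrable_continuous_real continuous_intros)
  moreover have "(LINT x:{a..b}|lborel. f x * deriv \<phi> x) = integral {a..b} (\<lambda>x. f x * deriv \<phi> x)"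
    "(LINT x:{a..b}|lborel. h x * \<phi> x) = integral {a..b} (\<lambda>x. h x * \<phi> x)"
    by (intro set_integral_Icc_continuous continuous_intros)+
  ultimately show "(LINT x:{a<..<b}|lborel. f x * deriv \<phi> x) = - (LINT x:{a<..<b}|lborel. h x * \<phi> x)"
    by (simp add: set_integral_Ioo_eq_Icc)
qed

lemma weak_deriv_measurable:
  assumes "a < b" "weak_deriv a b f h"
  shows "f \<in> borel_measurable (restrict_space lborel {a..b})"
    "h \<in> borel_measurable (restrict_space lborel {a..b})"
  using assms by (auto simp: weak_deriv_def intro: locally_integrable_measurable)

lemma continuous_on_measurable_Icc:
  fixes f :: "real \<Rightarrow> real"
  assumes "continuous_on {a..b} f"
  shows "f \<in> borel_measurable (restrict_space lborel {a..b})"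
  using borel_measurable_continuous_on_restrict[OF assms]
    measurable_cong_sets[of "restrict_space lborel {a..b}" "restrict_space borel {a..b}" borel borel]
  by (simp add: sets_restrict_space)

section \<open>Integration and square integrability with respect to a positive continuous
  density\<close>

lemma has_density_on_continuous:
  assumes "has_density_on a b \<mu> \<rho>" shows "continuous_on {a..b} \<rho>"
  using assms by (auto simp: has_density_on_def C01_plus_def)

lemma has_density_on_pos:
  assumes "has_density_on a b \<mu> \<rho>" "x \<in> {a..b}" shows "0 < \<rho> x"
  using assms by (cases "x = a"; cases "x = b") (auto simp: has_density_on_def C01_plus_def)

lemma has_density_on_measurable:
  assumes "has_density_on a b \<mu> \<rho>"
  shows "f \<in> borel_measurable \<mu> \<longleftrightarrow> f \<in> borel_measurable (restrict_space lborel {a..b})"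
  using assms by (auto simp: has_density_on_def)

lemma has_density_on_integral:
  fixes f :: "real \<Rightarrow> real"
  assumes \<mu>: "has_density_on a b \<mu> \<rho>" and f: "f \<in> borel_measurable (restrict_space lborel {a..b})"
  shows "(\<integral>x. f x \<partial>\<mu>) = (\<integral>x. \<rho> x * f x \<partial>restrict_space lborel {a..b})"
    "integrable \<mu> f \<longleftrightarrow> integrable (restrict_space lborel {a..b}) (\<lambda>x. \<rho> x * f x)"
proof -
  have "AE x in restrict_space lborel {a..b}. 0 \<le> \<rho> x"
    using has_density_on_pos[OF \<mu>] by (intro AE_I2) (auto simp: space_restrict_space less_imp_le)
  then show "(\<integral>x. f x \<partial>\<mu>) = (\<integral>x. \<rho> x * f x \<partial>restrict_space lborel {a..b})"
    "integrable \<mu> f \<longleftrightarrow> integrable (restrict_space lborel {a..b}) (\<lambda>x. \<rho> x * f x)"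
    using f continuous_on_measurable_Icc[OF has_density_on_continuous[OF \<mu>]] \<mu>
    by (auto simp: has_density_on_def integral_density integrable_density)
qed

lemma has_density_on_integral_continuous:
  fixes f :: "real \<Rightarrow> real"
  assumes \<mu>: "has_density_on a b \<mu> \<rho>" and f: "continuous_on {a..b} f"
  shows "(\<integral>x. f x \<partial>\<mu>) = integral {a..b} (\<lambda>x. \<rho> x * f x)" "integrable \<mu> f"
proof -
  have c: "continuous_on {a..b} (\<lambda>x. \<rho> x * f x)"
    by (intro continuous_intros has_density_on_continuous[OF \<mu>] f)
  show "(\<integral>x. f x \<partial>\<mu>) = integral {a..b} (\<lambda>x. \<rho> x * f x)"
    using has_density_on_integral(1)[OF \<mu> continuous_on_measurable_Icc[OF f]] set_integral_Icc_continuous[OF c]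
    by (simp add: integral_restrict_space set_lebesgue_integral_def)
  show "integrable \<mu> f"
    using has_density_on_integral(2)[OF \<mu> continuous_on_measurable_Icc[OF f]] borel_integrable_atLeastAtMost'[OF c]
    by (simp add: integrable_restrict_space set_integrable_def)
qed

text \<open>The estimates also cover non-integrable \<open>f\<close>: integrability holds for both
  measures or for neither, and in the latter case both Bochner integrals are 0.\<close>

lemma has_density_on_compare:
  fixes f :: "real \<Rightarrow> real"
  assumes \<mu>: "has_density_on a b \<mu> \<rho>" and f: "f \<in> borel_measurable (restrict_space lborel {a..b})"
    and nn: "\<And>x. x \<in> {a..b} \<Longrightarrow> 0 \<le> f x"
    and r: "0 < r" "\<And>x. x \<in> {a..b} \<Longrightarrow> r \<le> \<rho> x" "\<And>x. x \<in> {a..b} \<Longrightarrow> \<rho> x \<le> R"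
  shows "integrable \<mu> f \<longleftrightarrow> integrable (restrict_space lborel {a..b}) f"
    "r * (\<integral>x. f x \<partial>restrict_space lborel {a..b}) \<le> (\<integral>x. f x \<partial>\<mu>)"
    "(\<integral>x. f x \<partial>\<mu>) \<le> R * (\<integral>x. f x \<partial>restrict_space lborel {a..b})"
proof -
  let ?L = "restrict_space lborel {a..b}"
  have sp: "space ?L = {a..b}" by (simp add: space_restrict_space)
  have m: "\<rho> \<in> borel_measurable ?L"
    using \<mu> has_density_on_continuous continuous_on_measurable_Icc by blast
  have bd: "r * f x \<le> \<rho> x * f x" "\<rho> x * f x \<le> R * f x" if "x \<in> {a..b}" for x
    using r nn that by (auto intro: mult_right_mono)
  have bd': "0 \<le> r * f x" "0 \<le> \<rho> x * f x" if "x \<in> {a..b}" for x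
  proof -
    show "0 \<le> r * f x" using r(1) nn[OF that] by simp
    then show "0 \<le> \<rho> x * f x" using bd(1)[OF that] by linarith
  qed
  have "integrable ?L (\<lambda>x. \<rho> x * f x)" if "integrable ?L f"
    by (rule Bochner_Integration.integrable_bound[where f="\<lambda>x. R * f x"])
      (use that m f bd bd' in \<open>auto intro!: AE_I2 simp: sp intro: order_trans[OF _ abs_ge_self]\<close>)
  moreover have "integrable ?L f" if "integrable ?L (\<lambda>x. \<rho> x * f x)"
  proof -
    have "integrable ?L (\<lambda>x. r * f x)"
      by (rule Bochner_Integration.integrable_bound[OF that])
        (use m f bd bd' in \<open>auto intro!: AE_I2 simp: sp\<close>)
    then show ?thesis using r(1) by simp
  qed
  ultimately show iff: "integrable \<mu> f \<longleftrightarrow> integrable ?L f"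
    using has_density_on_integral(2)[OF \<mu> f] by blast
  show "r * (\<integral>x. f x \<partial>?L) \<le> (\<integral>x. f x \<partial>\<mu>)" "(\<integral>x. f x \<partial>\<mu>) \<le> R * (\<integral>x. f x \<partial>?L)"
  proof -
    have "(\<integral>x. r * f x \<partial>?L) \<le> (\<integral>x. f x \<partial>\<mu>) \<and> (\<integral>x. f x \<partial>\<mu>) \<le> (\<integral>x. R * f x \<partial>?L)"
    proof (cases "integrable ?L f")
      case True
      then have "integrable ?L (\<lambda>x. \<rho> x * f x)" using iff has_density_on_integral(2)[OF \<mu> f] by blast
      with True bd show ?thesis unfolding has_density_on_integral(1)[OF \<mu> f]
        by (intro conjI integral_mono) (simp_all add: sp)
    next
      case False
      then show ?thesis using iff by (simp add: not_integrable_integral_eq)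
    qed
    then show "r * (\<integral>x. f x \<partial>?L) \<le> (\<integral>x. f x \<partial>\<mu>)" "(\<integral>x. f x \<partial>\<mu>) \<le> R * (\<integral>x. f x \<partial>?L)"
      by simp_all
  qed
qed

text \<open>Lebesgue measure on \<open>{a..b}\<close> is the common reference through which square
  integrability passes from one density to another.\<close>

lemma L2_iff_lebesgue:
  assumes \<mu>: "has_density_on a b \<mu> \<rho>"
    and r: "0 < r" "\<And>x. x \<in> {a..b} \<Longrightarrow> r \<le> \<rho> x" "\<And>x. x \<in> {a..b} \<Longrightarrow> \<rho> x \<le> R"
  shows "f \<in> L2 \<mu> \<longleftrightarrow> f \<in> L2 (restrict_space lborel {a..b})"
  using has_density_on_compare(1)[OF \<mu> _ _ r, of "\<lambda>x. (f x)\<^sup>2"]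
  by (auto simp: L2_def has_density_on_measurable[OF \<mu>])

lemma has_density_on_bounds:
  assumes "a < b" "has_density_on a b \<mu> \<rho>"
  obtains r R where "0 < r" "\<And>x. x \<in> {a..b} \<Longrightarrow> r \<le> \<rho> x" "\<And>x. x \<in> {a..b} \<Longrightarrow> \<rho> x \<le> R"
proof -
  have c: "continuous_on {a..b} \<rho>" using assms(2) by (rule has_density_on_continuous)
  have ne: "{a..b} \<noteq> {}" using assms(1) by simp
  obtain x where x: "x \<in> {a..b}" "\<And>y. y \<in> {a..b} \<Longrightarrow> \<rho> x \<le> \<rho> y"
    using continuous_attains_inf[OF compact_Icc ne c] by blast
  obtain z where z: "\<And>y. y \<in> {a..b} \<Longrightarrow> \<rho> y \<le> \<rho> z"
    using continuous_attains_sup[OF compact_Icc ne c] by blast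
  show thesis using that[of "\<rho> x" "\<rho> z"] x z has_density_on_pos[OF assms(2)] by blast
qed

lemma L2_mult_integrable:
  fixes f g :: "real \<Rightarrow> real"
  assumes "f \<in> L2 M" "g \<in> L2 M"
  shows "integrable M (\<lambda>x. f x * g x)"
proof (rule Bochner_Integration.integrable_bound)
  show "integrable M (\<lambda>x. (f x)\<^sup>2 + (g x)\<^sup>2)" using assms by (simp add: L2_def)
  show "(\<lambda>x. f x * g x) \<in> borel_measurable M" using assms unfolding L2_def by (blast intro: borel_measurable_times)
  have "\<bar>f x * g x\<bar> \<le> (f x)\<^sup>2 + (g x)\<^sup>2" for x
  proof -
    have "0 \<le> \<bar>f x\<bar> * \<bar>g x\<bar>" by simp
    then show ?thesis using sum_squares_bound[of "\<bar>f x\<bar>" "\<bar>g x\<bar>"]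
      unfolding abs_mult power2_abs by linarith
  qed
  then show "AE x in M. norm (f x * g x) \<le> norm ((f x)\<^sup>2 + (g x)\<^sup>2)"
    by (auto intro!: AE_I2)
qed

text \<open>As a polynomial in \<open>t\<close> this is the expansion behind the first variation;
  with \<open>g\<close> equal to 1 and \<open>t\<close> minus the mean, it yields the
  variance.\<close>

lemma L2_add_mult:
  fixes f g :: "real \<Rightarrow> real"
  assumes "f \<in> L2 M" "g \<in> L2 M"
  shows "(\<lambda>x. f x + t * g x) \<in> L2 M"
    "(\<integral>x. (f x + t * g x)\<^sup>2 \<partial>M) =
      (\<integral>x. (f x)\<^sup>2 \<partial>M) + 2 * t * (\<integral>x. f x * g x \<partial>M) + t\<^sup>2 * (\<integral>x. (g x)\<^sup>2 \<partial>M)"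
proof -
  have eq: "(f x + t * g x)\<^sup>2 = (f x)\<^sup>2 + 2 * t * (f x * g x) + t\<^sup>2 * (g x)\<^sup>2" for x
    by (simp add: power2_eq_square algebra_simps)
  have i: "integrable M (\<lambda>x. (f x)\<^sup>2)" "integrable M (\<lambda>x. (g x)\<^sup>2)" "integrable M (\<lambda>x. f x * g x)"
    using assms L2_mult_integrable[OF assms] by (auto simp: L2_def)
  then show "(\<lambda>x. f x + t * g x) \<in> L2 M"
    using assms unfolding L2_def by (simp add: eq)
  show "(\<integral>x. (f x + t * g x)\<^sup>2 \<partial>M) =
      (\<integral>x. (f x)\<^sup>2 \<partial>M) + 2 * t * (\<integral>x. f x * g x \<partial>M) + t\<^sup>2 * (\<integral>x. (g x)\<^sup>2 \<partial>M)"
    unfolding eq using i by simp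
qed

section \<open>The du Bois-Reymond lemma\<close>

lemma continuous_antiderivative:
  fixes f :: "real \<Rightarrow> real"
  assumes "a < b" "continuous_on {a..b} f"
  obtains F where "\<And>x. x \<in> {a..b} \<Longrightarrow> (F has_real_derivative f x) (at x within {a..b})"
  using antiderivative_continuous[OF assms(2)] unfolding has_real_derivative_iff_has_vector_derivative
  by blast

lemma integral_by_antiderivative:
  fixes F f :: "real \<Rightarrow> real"
  assumes "\<And>x. x \<in> {a..b} \<Longrightarrow> (F has_real_derivative f x) (at x within {a..b})" "a \<le> b"
  shows "integral {a..b} f = F b - F a"
  using assms
  by (intro integral_unique fundamental_theorem_of_calculus)
     (auto simp: has_real_derivative_iff_has_vector_derivative)

lemma integral_by_parts_real:
  fixes F G f g :: "real \<Rightarrow> real"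
  assumes "a \<le> b"
    and F: "\<And>x. x \<in> {a..b} \<Longrightarrow> (F has_real_derivative f x) (at x within {a..b})" "continuous_on {a..b} f"
    and G: "\<And>x. x \<in> {a..b} \<Longrightarrow> (G has_real_derivative g x) (at x within {a..b})" "continuous_on {a..b} g"
  shows "integral {a..b} (\<lambda>x. f x * G x) = F b * G b - F a * G a - integral {a..b} (\<lambda>x. F x * g x)"
proof -
  have [continuous_intros]: "continuous_on {a..b} F" "continuous_on {a..b} G"
    using F(1) G(1) DERIV_continuous_on by blast+
  note [continuous_intros] = F(2) G(2)
  have "integral {a..b} (\<lambda>x. f x * G x + F x * g x) = F b * G b - F a * G a"
    using assms(1) DERIV_mult[OF F(1) G(1)]
    by (intro integral_by_antiderivative) (auto simp: mult.commute add.commute)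
  moreover have "integral {a..b} (\<lambda>x. f x * G x + F x * g x) =
      integral {a..b} (\<lambda>x. f x * G x) + integral {a..b} (\<lambda>x. F x * g x)"
    by (intro Henstock_Kurzweil_Integration.integral_add integrable_continuous_real continuous_intros)
  ultimately show ?thesis by simp
qed

text \<open>The antiderivative that vanishes at \<open>c\<close> is 0 to the left of
  \<open>c\<close>; the vanishing integral brings it back to 0 at \<open>d\<close>, and it stays 0
  from there on.\<close>

lemma test_function_antiderivative:
  fixes \<eta> :: "real \<Rightarrow> real"
  assumes cd: "a < c" "c < d" "d < b" and \<eta>: "continuous_on UNIV \<eta>" "\<And>x. x \<notin> {c..d} \<Longrightarrow> \<eta> x = 0"
    and 0: "integral {c..d} \<eta> = 0"
  obtains \<phi> where "test_function a b \<phi>" "deriv \<phi> = \<eta>"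
proof -
  obtain F where F': "\<forall>x. - \<infinity> < ereal x \<longrightarrow> ereal x < \<infinity> \<longrightarrow> (F has_vector_derivative \<eta> x) (at x)"
    using einterval_antiderivative[of "-\<infinity>" "\<infinity>" \<eta>] \<eta>(1) by (auto simp: continuous_on_eq_continuous_at)
  have F: "(F has_real_derivative \<eta> x) (at x)" for x
    using F' by (auto simp: has_real_derivative_iff_has_vector_derivative)
  define \<phi> where "\<phi> x = F x - F c" for x
  have \<phi>: "(\<phi> has_real_derivative \<eta> x) (at x)" for x
    unfolding \<phi>_def by (auto intro!: derivative_eq_intros F)
  have "integral {c..d} \<eta> = \<phi> d - \<phi> c"
    using cd by (intro integral_by_antiderivative has_field_derivative_at_within[OF \<phi>]) auto
  then have d: "\<phi> d = 0" using 0 by (simp add: \<phi>_def)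
  have cont: "continuous_on S \<phi>" for S
    using \<phi> DERIV_continuous_on has_field_derivative_at_within by blast
  have "\<phi> x = 0" if "x \<notin> {c..d}" for x
  proof (cases "x < c")
    case True
    have "\<phi> c = \<phi> x"
    proof (rule DERIV_isconst_end[OF True cont])
      fix y assume "x < y" "y < c"
      then have "\<eta> y = 0" using \<eta>(2)[of y] by simp
      then show "DERIV \<phi> y :> 0" using \<phi>[of y] by simp
    qed
    then show ?thesis by (simp add: \<phi>_def)
  next
    case False
    with that have "d < x" by simp
    have "\<phi> x = \<phi> d"
    proof (rule DERIV_isconst_end[OF \<open>d < x\<close> cont])
      fix y assume "d < y" "y < x"
      then have "\<eta> y = 0" using \<eta>(2)[of y] by simp
      then show "DERIV \<phi> y :> 0" using \<phi>[of y] by simp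
    qed
    then show ?thesis using d by simp
  qed
  then have "test_function a b \<phi>"
    unfolding test_function_def C1_differentiable_on_def
    using cd \<phi> \<eta>(1) by (auto simp: has_real_derivative_iff_has_vector_derivative)
  moreover have "deriv \<phi> = \<eta>" using \<phi> DERIV_imp_deriv by blast
  ultimately show thesis by (rule that)
qed

text \<open>The test function is an antiderivative of \<open>k (u - m)\<close>, where \<open>k\<close> is a bump on \<open>[c,d]\<close> and
  \<open>m\<close> is the \<open>k\<close>-weighted mean of \<open>u\<close>; the hypothesis then says that \<open>\<integral> k (u - m)\<^sup>2 = 0\<close>.\<close>

lemma du_Bois_Reymond_continuous:
  fixes u :: "real \<Rightarrow> real"
  assumes "a < b" and u: "continuous_on {a..b} u"
    and 0: "\<And>\<phi>. test_function a b \<phi> \<Longrightarrow> integral {a..b} (\<lambda>x. u x * deriv \<phi> x) = 0"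
  obtains m where "\<And>x. x \<in> {a..b} \<Longrightarrow> u x = m"
proof -
  have const: "u p = u q" if pq: "a < p" "p < q" "q < b" for p q
  proof -
    \<comment> \<open>The midpoints put \<open>p\<close> and \<open>q\<close> strictly inside the
      support of the bump, which itself stays inside the open interval from \<open>a\<close> to
      \<open>b\<close>.\<close>
    define c where "c = (a + p) / 2"
    define d where "d = (q + b) / 2"
    have cd: "a < c" "c < d" "d < b" "c < p" "q < d" using pq by (auto simp: c_def d_def)
    define k where "k x = max 0 ((x - c) * (d - x))" for x
    \<comment> \<open>\<open>u\<close> is continued by its endpoint values, because the derivative
      of a test function must be continuous on the whole line.\<close>
    define v where "v x = u (max a (min b x))" for x
    have ck [continuous_intros]: "continuous_on S k" for S unfolding k_def by (intro continuous_intros)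
    have cv [continuous_intros]: "continuous_on S v" for S
      unfolding v_def by (rule continuous_on_compose2[OF u]) (use \<open>a < b\<close> in \<open>auto intro!: continuous_intros\<close>)
    have vu: "v x = u x" if "x \<in> {a..b}" for x using that by (auto simp: v_def)
    have k0: "k x = 0" if "x \<notin> {c..d}" for x
    proof -
      have "(x - c) * (d - x) \<le> 0"
        using that cd by (cases "x < c") (auto intro: mult_nonpos_nonneg mult_nonneg_nonpos)
      then show ?thesis by (simp add: k_def)
    qed
    have kpos: "0 < k x" if "x \<in> {c<..<d}" for x using that by (auto simp: k_def)
    have knn: "0 \<le> k x" for x by (simp add: k_def)
    define m where "m = integral {c..d} (\<lambda>x. k x * v x) / integral {c..d} k"
    have "integral {c..d} k \<noteq> 0"
    proof
      assume "integral {c..d} k = 0"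
      then have "k p = 0"
        using integral_eq_0_iff[of c d k] ck knn cd pq by auto
      then show False using kpos[of p] cd pq by auto
    qed
    then have km: "integral {c..d} (\<lambda>x. k x * (v x - m)) = 0"
    proof -
      have "integral {c..d} (\<lambda>x. k x * (v x - m)) = integral {c..d} (\<lambda>x. k x * v x - m * k x)"
        by (simp add: algebra_simps)
      also have "\<dots> = integral {c..d} (\<lambda>x. k x * v x) - integral {c..d} (\<lambda>x. m * k x)"
        by (intro Henstock_Kurzweil_Integration.integral_diff integrable_continuous_real continuous_intros)
      finally show ?thesis using \<open>integral {c..d} k \<noteq> 0\<close> by (simp add: m_def)
    qed
    define \<eta> where "\<eta> x = k x * (v x - m)" for x
    have c\<eta> [continuous_intros]: "continuous_on S \<eta>" for S unfolding \<eta>_def by (intro continuous_intros)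
    obtain \<phi> where \<phi>: "test_function a b \<phi>" "deriv \<phi> = \<eta>"
    proof (rule test_function_antiderivative[OF cd(1-3) c\<eta>])
      show "\<eta> x = 0" if "x \<notin> {c..d}" for x using k0[OF that] by (simp add: \<eta>_def)
      have "\<eta> = (\<lambda>x. k x * (v x - m))" by (simp add: \<eta>_def fun_eq_iff)
      then show "integral {c..d} \<eta> = 0" using km by simp
    qed
    have "integral {a..b} (\<lambda>x. v x * \<eta> x) = integral {a..b} (\<lambda>x. u x * deriv \<phi> x)"
      unfolding \<phi>(2) by (rule integral_cong) (simp add: vu)
    also have "\<dots> = 0" by (rule 0[OF \<phi>(1)])
    finally have "integral {a..b} (\<lambda>x. v x * \<eta> x) = 0" .
    moreover have "((\<lambda>x. v x * \<eta> x) has_integral integral {c..d} (\<lambda>x. v x * \<eta> x)) {a..b}"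
      by (rule has_integral_on_superset[OF integrable_integral[OF integrable_continuous_real]])
        (use cd k0 in \<open>auto simp: \<eta>_def intro!: continuous_intros\<close>)
    ultimately have v\<eta>: "integral {c..d} (\<lambda>x. v x * \<eta> x) = 0" using integral_unique by metis
    have "integral {c..d} (\<lambda>x. k x * (v x - m)\<^sup>2) = integral {c..d} (\<lambda>x. v x * \<eta> x - m * \<eta> x)"
      by (simp add: \<eta>_def power2_eq_square algebra_simps)
    also have "\<dots> = integral {c..d} (\<lambda>x. v x * \<eta> x) - integral {c..d} (\<lambda>x. m * \<eta> x)"
      by (intro Henstock_Kurzweil_Integration.integral_diff integrable_continuous_real continuous_intros)
    also have "\<dots> = 0" using v\<eta> km by (simp add: \<eta>_def)
    finally have "integral {c..d} (\<lambda>x. k x * (v x - m)\<^sup>2) = 0" .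
    moreover have "continuous_on {c..d} (\<lambda>x. k x * (v x - m)\<^sup>2)" by (intro continuous_intros)
    ultimately have z: "k x * (v x - m)\<^sup>2 = 0" if "x \<in> {c..d}" for x
      using integral_eq_0_iff[of c d "\<lambda>x. k x * (v x - m)\<^sup>2"] knn cd that by auto
    have "v p = m" "v q = m"
      using z[of p] z[of q] kpos[of p] kpos[of q] cd pq by auto
    then show ?thesis using vu[of p] vu[of q] pq by simp
  qed
  define m where "m = u ((a + b) / 2)"
  have m: "u x = m" if "x \<in> {a<..<b}" for x
  proof (cases x "(a + b) / 2" rule: linorder_cases)
    case less
    then show ?thesis unfolding m_def by (rule const[rotated]) (use that in auto)
  next
    case greater
    then show ?thesis unfolding m_def by (rule const[symmetric, rotated]) (use that in auto)
  qed (simp only: m_def)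
  have "u x = m" if "x \<in> {a..b}" for x
  proof (rule continuous_constant_on_closure[where S="{a<..<b}" and f=u])
    show "continuous_on (closure {a<..<b}) u" using u \<open>a < b\<close> by simp
  qed (use m that \<open>a < b\<close> in auto)
  then show thesis by (rule that)
qed

text \<open>The first-order condition at an extremum: for small \<open>t\<close> of the sign of
  \<open>p\<close>, the linear term would dominate.\<close>

lemma linear_le_quadratic_imp_zero:
  fixes p q :: real
  assumes "\<And>t. t * p \<le> t\<^sup>2 * q"
  shows "p = 0"
proof (rule ccontr)
  assume "p \<noteq> 0"
  \<comment> \<open>Positive and larger than \<open>q\<close>, so that inserting
    \<open>t = p / r\<close> gives \<open>r \<le> q\<close>, which is impossible.\<close>
  define r where "r = \<bar>q\<bar> + 1"
  have "p / r * p \<le> (p / r)\<^sup>2 * q" by (rule assms)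
  moreover have "r > 0" by (simp add: r_def)
  ultimately have "p\<^sup>2 * r \<le> p\<^sup>2 * q" by (simp add: field_simps power2_eq_square)
  then have "r \<le> q" using \<open>p \<noteq> 0\<close> by (simp add: mult_le_cancel_left)
  then show False by (simp add: r_def)
qed

lemma weak_deriv_const: "a < b \<Longrightarrow> weak_deriv a b (\<lambda>_. k) (\<lambda>_. 0)"
  by (rule weak_deriv_classical) auto

lemma L2_continuous:
  assumes \<mu>: "has_density_on a b \<mu> \<rho>" and f: "continuous_on {a..b} f"
  shows "f \<in> L2 \<mu>"
  unfolding L2_def using has_density_on_measurable[OF \<mu>] continuous_on_measurable_Icc[OF f]
    has_density_on_integral_continuous(2)[OF \<mu>, of "\<lambda>x. (f x)\<^sup>2"] f
  by (auto intro: continuous_intros)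

lemma H1_classical:
  assumes "a < b" "has_density_on a b \<mu> \<rho>"
    and f: "\<And>x. x \<in> {a..b} \<Longrightarrow> (f has_real_derivative h x) (at x within {a..b})"
    and h: "continuous_on {a..b} h"
  shows "f \<in> H1 a b \<mu> (\<lambda>_. 1)"
proof -
  have "continuous_on {a..b} f" using f DERIV_continuous_on by blast
  then show ?thesis
    using weak_deriv_classical[OF assms(1) f h] L2_continuous[OF assms(2)] h by (auto simp: H1_def)
qed

section \<open>The Euler-Lagrange equation of a saturating function\<close>

lemma poincare_with_classical:
  assumes ab: "a < b" and \<mu>: "has_density_on a b \<mu> \<rho>" "prob_space \<mu>"
    and P: "poincare_with a b \<mu> (\<lambda>_. 1) C"
    and u: "\<And>x. x \<in> {a..b} \<Longrightarrow> (u has_real_derivative v x) (at x within {a..b})"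
    and v: "continuous_on {a..b} v"
  shows "integral {a..b} (\<lambda>x. \<rho> x * (u x)\<^sup>2) - (integral {a..b} (\<lambda>x. \<rho> x * u x))\<^sup>2
    \<le> C * integral {a..b} (\<lambda>x. \<rho> x * (v x)\<^sup>2)"
proof -
  interpret prob_space \<mu> by (rule \<mu>(2))
  have cu: "continuous_on {a..b} u" by (rule DERIV_continuous_on[OF u])
  define m where "m = integral {a..b} (\<lambda>x. \<rho> x * u x)"
  have m: "(\<integral>x. u x \<partial>\<mu>) = m" "integrable \<mu> u"
    using has_density_on_integral_continuous[OF \<mu>(1) cu] by (auto simp: m_def)
  have d: "((\<lambda>x. u x + (-m) * 1) has_real_derivative v x) (at x within {a..b})" if "x \<in> {a..b}" for x
    by (auto intro!: derivative_eq_intros u that)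
  have "(\<integral>x. (u x + (-m) * 1)\<^sup>2 \<partial>\<mu>) \<le> C * (\<integral>x. 1 * (v x)\<^sup>2 \<partial>\<mu>)"
    using P H1_classical[OF ab \<mu>(1) d v] weak_deriv_classical[OF ab d v] m
    by (auto simp: poincare_with_def prob_space)
  moreover have "(\<integral>x. (u x + (-m) * 1)\<^sup>2 \<partial>\<mu>) = (\<integral>x. (u x)\<^sup>2 \<partial>\<mu>) - m\<^sup>2"
    using L2_add_mult(2)[OF L2_continuous[OF \<mu>(1) cu] L2_continuous[OF \<mu>(1) continuous_on_const], of "-m" 1] m
    by (simp add: prob_space power2_eq_square)
  moreover have "(\<integral>x. (u x)\<^sup>2 \<partial>\<mu>) = integral {a..b} (\<lambda>x. \<rho> x * (u x)\<^sup>2)"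
    "(\<integral>x. (v x)\<^sup>2 \<partial>\<mu>) = integral {a..b} (\<lambda>x. \<rho> x * (v x)\<^sup>2)"
    by (auto intro!: has_density_on_integral_continuous(1)[OF \<mu>(1)] continuous_intros cu v)
  ultimately show ?thesis by (simp add: m_def)
qed

text \<open>The difference between the two sides of the Poincare inequality for
  \<open>f + t w\<close> is a quadratic polynomial in \<open>t\<close> of constant sign. It vanishes
  at \<open>t = 0\<close> because \<open>f\<close> attains equality, so its linear coefficient is
  0.\<close>

lemma saturates_euler_lagrange:
  assumes ab: "a < b" and \<mu>: "has_density_on a b \<mu> \<rho>" "prob_space \<mu>"
    and P: "poincare_with a b \<mu> (\<lambda>_. 1) C"
    and f: "f \<in> L2 \<mu>" "(\<integral>x. f x \<partial>\<mu>) = 0"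
    and h: "weak_deriv a b f h" "h \<in> L2 \<mu>"
    and eq: "(\<integral>x. (f x)\<^sup>2 \<partial>\<mu>) = C * (\<integral>x. (h x)\<^sup>2 \<partial>\<mu>)"
    and u: "\<And>x. x \<in> {a..b} \<Longrightarrow> (u has_real_derivative v x) (at x within {a..b})"
    and v: "continuous_on {a..b} v"
  shows "(\<integral>x. f x * u x \<partial>\<mu>) = C * (\<integral>x. h x * v x \<partial>\<mu>)"
proof -
  interpret prob_space \<mu> by (rule \<mu>(2))
  have cu: "continuous_on {a..b} u" by (rule DERIV_continuous_on[OF u])
  have L2u: "u \<in> L2 \<mu>" "v \<in> L2 \<mu>" using L2_continuous[OF \<mu>(1)] cu v by auto
  have if1: "integrable \<mu> f"
    using L2_mult_integrable[OF f(1) L2_continuous[OF \<mu>(1) continuous_on_const], of 1] by simp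
  \<comment> \<open>Recentring \<open>u\<close> keeps the perturbed function within the mean-zero
    constraint. The shift drops out at the end, because \<open>f\<close> has mean zero too.\<close>
  define m where "m = (\<integral>x. u x \<partial>\<mu>)"
  define w where "w x = u x - m" for x
  have iu: "integrable \<mu> u" using has_density_on_integral_continuous(2)[OF \<mu>(1) cu] .
  have w: "(w has_real_derivative v x) (at x within {a..b})" if "x \<in> {a..b}" for x
    unfolding w_def by (auto intro!: derivative_eq_intros u that)
  have cw: "continuous_on {a..b} w" unfolding w_def by (intro continuous_intros cu)
  have L2w: "w \<in> L2 \<mu>" using L2_continuous[OF \<mu>(1) cw] .
  have iw: "(\<integral>x. w x \<partial>\<mu>) = 0" "integrable \<mu> w"
    using iu unfolding w_def by (simp_all add: prob_space m_def)
  define p where "p = 2 * ((\<integral>x. f x * w x \<partial>\<mu>) - C * (\<integral>x. h x * v x \<partial>\<mu>))"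
  have "t * p \<le> t\<^sup>2 * (C * (\<integral>x. (v x)\<^sup>2 \<partial>\<mu>) - (\<integral>x. (w x)\<^sup>2 \<partial>\<mu>))" for t
  proof -
    have wd: "weak_deriv a b (\<lambda>x. f x + t * w x) (\<lambda>x. h x + t * v x)"
      by (rule weak_deriv_add_mult[OF h(1) weak_deriv_classical[OF ab w v]])
    moreover have "(\<lambda>x. f x + t * w x) \<in> H1 a b \<mu> (\<lambda>_. 1)"
      unfolding H1_def using wd L2_add_mult(1)[OF f(1) L2w] L2_add_mult(1)[OF h(2) L2u(2)] by auto
    moreover have "(\<integral>x. f x + t * w x \<partial>\<mu>) = 0" using if1 iw f(2) by simp
    ultimately have "(\<integral>x. (f x + t * w x)\<^sup>2 \<partial>\<mu>) \<le> C * (\<integral>x. 1 * (h x + t * v x)\<^sup>2 \<partial>\<mu>)"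
      using P unfolding poincare_with_def by blast
    then show ?thesis
      unfolding mult_1 L2_add_mult(2)[OF f(1) L2w] L2_add_mult(2)[OF h(2) L2u(2)] eq p_def
      by (simp add: algebra_simps)
  qed
  then have "p = 0" by (rule linear_le_quadratic_imp_zero)
  moreover have "(\<integral>x. f x * w x \<partial>\<mu>) = (\<integral>x. f x * u x - m * f x \<partial>\<mu>)"
    by (simp add: w_def algebra_simps)
  then have "(\<integral>x. f x * w x \<partial>\<mu>) = (\<integral>x. f x * u x \<partial>\<mu>)"
    using L2_mult_integrable[OF f(1) L2u(1)] if1 f(2) by simp
  ultimately show ?thesis by (simp add: p_def)
qed

lemma saturates_imp_ode:
  assumes ab: "a < b" and \<mu>: "has_density_on a b \<mu> \<rho>" "prob_space \<mu>"
    and sat: "saturates a b \<mu> (\<lambda>_. 1) f"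
  obtains C G where "0 < C" "poincare_with a b \<mu> (\<lambda>_. 1) C" "G a = 0" "G b = 0"
    "\<And>x. x \<in> {a..b} \<Longrightarrow> (G has_real_derivative \<rho> x * f x) (at x within {a..b})"
    "\<And>x. x \<in> {a..b} \<Longrightarrow> (f has_real_derivative - G x / (C * \<rho> x)) (at x within {a..b})"
proof -
  have cr [continuous_intros]: "continuous_on {a..b} \<rho>" using has_density_on_continuous[OF \<mu>(1)] .
  have rpos: "0 < \<rho> x" if "x \<in> {a..b}" for x using has_density_on_pos[OF \<mu>(1) that] .
  have f: "f \<in> L2 \<mu>" "continuous_on {a..b} f" "\<not> (AE x in \<mu>. f x = 0)" "(\<integral>x. f x \<partial>\<mu>) = 0"
    using sat by (auto simp: saturates_def H1_def)
  note [continuous_intros] = f(2)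
  obtain C h where P: "poincare_with a b \<mu> (\<lambda>_. 1) C" and h: "weak_deriv a b f h"
    and eq: "(\<integral>x. (f x)\<^sup>2 \<partial>\<mu>) = C * (\<integral>x. (h x)\<^sup>2 \<partial>\<mu>)"
    using sat by (auto simp: saturates_def is_poincare_constant_def)
  have C: "0 < C" using P by (simp add: poincare_with_def)
  \<comment> \<open>Membership in \<open>H1\<close> speaks of some weak derivative, not of this
    \<open>h\<close>. That \<open>h\<close> is square integrable is read off the equality: otherwise
    its energy would be the default value 0 and \<open>f\<close> would vanish almost
    everywhere.\<close>
  have "(\<integral>x. (f x)\<^sup>2 \<partial>\<mu>) \<noteq> 0"
    using f(1,3) by (subst integral_nonneg_eq_0_iff_AE) (auto simp: L2_def)
  then have "(\<integral>x. (h x)\<^sup>2 \<partial>\<mu>) \<noteq> 0" using eq by auto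
  then have "integrable \<mu> (\<lambda>x. (h x)\<^sup>2)" using not_integrable_integral_eq by blast
  then have hL2: "h \<in> L2 \<mu>"
    using weak_deriv_measurable(2)[OF ab h] by (simp add: L2_def has_density_on_measurable[OF \<mu>(1)])
  obtain G0 where G0: "\<And>x. x \<in> {a..b} \<Longrightarrow> (G0 has_real_derivative \<rho> x * f x) (at x within {a..b})"
    using continuous_antiderivative[OF ab, of "\<lambda>x. \<rho> x * f x"] by (auto intro: continuous_intros)
  define G where "G x = G0 x - G0 a" for x
  have G: "(G has_real_derivative \<rho> x * f x) (at x within {a..b})" if "x \<in> {a..b}" for x
    unfolding G_def by (auto intro!: derivative_eq_intros G0 that)
  have "(\<integral>x. f x \<partial>\<mu>) = integral {a..b} (\<lambda>x. \<rho> x * f x)"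
    by (rule has_density_on_integral_continuous(1)[OF \<mu>(1) f(2)])
  also have "\<dots> = G b - G a" using G ab by (intro integral_by_antiderivative) auto
  finally have Gb: "G b = 0" using f(4) by (simp add: G_def)
  have cG [continuous_intros]: "continuous_on {a..b} G" by (rule DERIV_continuous_on[OF G])
  have cGr: "continuous_on {a..b} (\<lambda>x. G x / \<rho> x)"
    using rpos by (intro continuous_intros) force+
  \<comment> \<open>\<open>K\<close> allows a second integration by parts, from
    \<open>\<phi>\<close> to its derivative. The Euler-Lagrange equation then says that
    \<open>C f + K\<close> is orthogonal to the derivatives of all test functions.\<close>
  obtain K where K: "\<And>x. x \<in> {a..b} \<Longrightarrow> (K has_real_derivative G x / \<rho> x) (at x within {a..b})"
    using continuous_antiderivative[OF ab cGr] by blast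
  have cK [continuous_intros]: "continuous_on {a..b} K" by (rule DERIV_continuous_on[OF K])
  have "integral {a..b} (\<lambda>x. (C * f x + K x) * deriv \<phi> x) = 0" if \<phi>: "test_function a b \<phi>" for \<phi>
  proof -
    obtain c d where cd: "a < c" "c < d" "d < b" "\<And>x. x \<notin> {c..d} \<Longrightarrow> \<phi> x = 0"
        "\<And>x. (\<phi> has_real_derivative deriv \<phi> x) (at x)"
        "continuous_on UNIV (deriv \<phi>)" "continuous_on UNIV \<phi>"
      using \<phi> by (rule test_functionE) blast
    have [continuous_intros]: "continuous_on {a..b} (deriv \<phi>)" "continuous_on {a..b} \<phi>"
      using cd continuous_on_subset by blast+
    have \<phi>0: "\<phi> a = 0" "\<phi> b = 0" using cd by auto
    have c\<phi>r: "continuous_on {a..b} (\<lambda>x. \<phi> x / \<rho> x)"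
      using rpos by (intro continuous_intros) force+
    obtain u where u: "\<And>x. x \<in> {a..b} \<Longrightarrow> (u has_real_derivative \<phi> x / \<rho> x) (at x within {a..b})"
      using continuous_antiderivative[OF ab c\<phi>r] by blast
    have cu [continuous_intros]: "continuous_on {a..b} u" by (rule DERIV_continuous_on[OF u])
    have EL: "(\<integral>x. f x * u x \<partial>\<mu>) = C * (\<integral>x. h x * (\<phi> x / \<rho> x) \<partial>\<mu>)"
      by (rule saturates_euler_lagrange[OF ab \<mu> P f(1,4) h hL2 eq u c\<phi>r])
    have "(\<integral>x. f x * u x \<partial>\<mu>) = integral {a..b} (\<lambda>x. \<rho> x * f x * u x)"
      using has_density_on_integral_continuous(1)[OF \<mu>(1), of "\<lambda>x. f x * u x"]
      by (simp add: mult.assoc continuous_intros)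
    also have "\<dots> = - integral {a..b} (\<lambda>x. G x * (\<phi> x / \<rho> x))"
      using Gb ab c\<phi>r by (subst integral_by_parts_real[OF _ G _ u]) (auto simp: G_def intro!: continuous_intros)
    also have "\<dots> = - integral {a..b} (\<lambda>x. G x / \<rho> x * \<phi> x)" by simp
    also have "\<dots> = integral {a..b} (\<lambda>x. K x * deriv \<phi> x)"
      using ab cGr \<phi>0 has_field_derivative_at_within[OF cd(5)]
      by (subst integral_by_parts_real[OF _ K, where G=\<phi> and g="deriv \<phi>"]) (auto intro!: continuous_intros)
    finally have 1: "(\<integral>x. f x * u x \<partial>\<mu>) = integral {a..b} (\<lambda>x. K x * deriv \<phi> x)" .
    have "(\<integral>x. h x * (\<phi> x / \<rho> x) \<partial>\<mu>)
        = (\<integral>x. \<rho> x * (h x * (\<phi> x / \<rho> x)) \<partial>restrict_space lborel {a..b})"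
      using weak_deriv_measurable(2)[OF ab h] continuous_on_measurable_Icc[OF c\<phi>r]
      by (intro has_density_on_integral(1)[OF \<mu>(1)] borel_measurable_times)
    also have "\<dots> = (\<integral>x. h x * \<phi> x \<partial>restrict_space lborel {a..b})"
      using rpos by (intro Bochner_Integration.integral_cong) (force simp: space_restrict_space)+
    also have "\<dots> = (LINT x:{a<..<b}|lborel. h x * \<phi> x)"
      unfolding set_integral_Ioo_eq_Icc by (simp add: integral_restrict_space set_lebesgue_integral_def)
    also have "\<dots> = - (LINT x:{a<..<b}|lborel. f x * deriv \<phi> x)"
      using h \<phi> by (auto simp: weak_deriv_def)
    also have "\<dots> = - integral {a..b} (\<lambda>x. f x * deriv \<phi> x)"
      unfolding set_integral_Ioo_eq_Icc by (subst set_integral_Icc_continuous) (auto intro!: continuous_intros)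
    finally have 2: "(\<integral>x. h x * (\<phi> x / \<rho> x) \<partial>\<mu>) = - integral {a..b} (\<lambda>x. f x * deriv \<phi> x)" .
    have "integral {a..b} (\<lambda>x. (C * f x + K x) * deriv \<phi> x) =
        integral {a..b} (\<lambda>x. C * (f x * deriv \<phi> x) + K x * deriv \<phi> x)"
      by (simp add: algebra_simps)
    also have "\<dots> = integral {a..b} (\<lambda>x. C * (f x * deriv \<phi> x)) + integral {a..b} (\<lambda>x. K x * deriv \<phi> x)"
      by (intro Henstock_Kurzweil_Integration.integral_add integrable_continuous_real continuous_intros)
    finally show ?thesis using EL 1 2 by simp
  qed
  moreover have "continuous_on {a..b} (\<lambda>x. C * f x + K x)" by (intro continuous_intros)
  ultimately obtain m where m: "\<And>x. x \<in> {a..b} \<Longrightarrow> C * f x + K x = m"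
    using du_Bois_Reymond_continuous[OF ab] by blast
  \<comment> \<open>Since \<open>C f + K\<close> is constant up to the endpoints, \<open>f\<close>
    inherits the classical derivative of \<open>- K / C\<close>, one-sided at \<open>a\<close> and
    \<open>b\<close>.\<close>
  have "(f has_real_derivative - G x / (C * \<rho> x)) (at x within {a..b})" if x: "x \<in> {a..b}" for x
  proof (rule has_field_derivative_transform_within[OF _ zero_less_one x])
    show "((\<lambda>x. (m - K x) / C) has_real_derivative - G x / (C * \<rho> x)) (at x within {a..b})"
      using C by (auto intro!: derivative_eq_intros K x)
    show "(m - K y) / C = f y" if "y \<in> {a..b}" for y
      using m[OF that] C by (simp add: field_simps)
  qed
  then show thesis using that[OF C P _ Gb G] by (simp add: G_def)
qed

text \<open>Since \<open>f' c = 0\<close>, freezing \<open>f\<close> at its value from \<open>c\<close> on gives a \<open>C\<^sup>1\<close> competitor, which violates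
  the variance inequality unless \<open>f c = 0\<close>.\<close>

lemma ode_zero_imp_value_zero:
  fixes f G \<rho> :: "real \<Rightarrow> real"
  assumes C: "0 < C" and c: "a < c" "c < b" and \<rho>: "continuous_on {a..b} \<rho>" "\<And>x. x \<in> {a..b} \<Longrightarrow> 0 < \<rho> x"
    "integral {a..b} \<rho> = 1"
    and G: "\<And>x. x \<in> {a..b} \<Longrightarrow> (G has_real_derivative \<rho> x * f x) (at x within {a..b})" "G a = 0" "G c = 0"
    and f: "\<And>x. x \<in> {a..b} \<Longrightarrow> (f has_real_derivative - G x / (C * \<rho> x)) (at x within {a..b})"
    and var: "\<And>u v. (\<And>x. x \<in> {a..b} \<Longrightarrow> (u has_real_derivative v x) (at x within {a..b})) \<Longrightarrow>
      continuous_on {a..b} v \<Longrightarrow>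
      integral {a..b} (\<lambda>x. \<rho> x * (u x)\<^sup>2) - (integral {a..b} (\<lambda>x. \<rho> x * u x))\<^sup>2
        \<le> C * integral {a..b} (\<lambda>x. \<rho> x * (v x)\<^sup>2)"
  shows "f c = 0"
proof -
  have sub: "{a..c} \<subseteq> {a..b}" "{c..b} \<subseteq> {a..b}" "c \<in> {a..b}" using c by auto
  have cG: "continuous_on {a..b} G" and cf: "continuous_on {a..b} f"
    by (rule DERIV_continuous_on[OF G(1)], simp) (rule DERIV_continuous_on[OF f], simp)
  have cf': "continuous_on {a..b} (\<lambda>x. - G x / (C * \<rho> x))"
    using C \<rho>(2) by (intro continuous_intros cG \<rho>(1)) force
  define u where "u x = (if x \<le> c then f x else f c)" for x
  define v where "v x = (if x \<le> c then - G x / (C * \<rho> x) else 0)" for x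
  \<comment> \<open>The two branches match at \<open>c\<close> because
    \<open>G c = 0\<close>.\<close>
  have cv: "continuous_on {a..b} v"
  proof -
    have "continuous_on ({a..c} \<union> {c..b}) v"
      unfolding v_def using sub c G(3)
      by (intro continuous_on_cases_le continuous_on_subset[OF cf'] continuous_intros) auto
    also have "{a..c} \<union> {c..b} = {a..b}" using c by auto
    finally show ?thesis .
  qed
  have u: "(u has_real_derivative v x) (at x within {a..b})" if x: "x \<in> {a..b}" for x
  proof -
    have "((\<lambda>x. if x \<in> {a..c} then f x else f c) has_vector_derivative
        (if x \<in> {a..c} then - G x / (C * \<rho> x) else 0)) (at x within {a..b})"
    proof (rule has_vector_derivative_If_within_closures[where T="{c..b}"])
      show "{a..b} = {a..c} \<union> {c..b}" using c by auto
      show "(f has_vector_derivative - G x / (C * \<rho> x)) (at x within {a..c} \<union> closure {a..c} \<inter> closure {c..b})"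
        if "x \<in> {a..c} \<union> closure {a..c} \<inter> closure {c..b}"
      proof -
        have "{a..c} \<union> closure {a..c} \<inter> closure {c..b} = {a..c}" using c by auto
        then show ?thesis using DERIV_subset[OF f[OF x] sub(1)]
          by (simp add: has_real_derivative_iff_has_vector_derivative)
      qed
    qed (use c x G(3) in auto)
    moreover have "(if x \<in> {a..c} then - G x / (C * \<rho> x) else 0) = v x"
      using x by (auto simp: v_def)
    ultimately have "((\<lambda>x. if x \<in> {a..c} then f x else f c) has_real_derivative v x) (at x within {a..b})"
      by (simp only: has_real_derivative_iff_has_vector_derivative)
    then show ?thesis
      by (rule has_field_derivative_transform_within[OF _ zero_less_one x]) (auto simp: u_def)
  qed
  have cu: "continuous_on {a..b} u" by (rule DERIV_continuous_on[OF u])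
  \<comment> \<open>The mass to the right of \<open>c\<close>, which lies strictly between 0 and
    1.\<close>
  define q where "q = integral {c..b} \<rho>"
  have qpos: "0 < integral {c..b} \<rho>" "0 < integral {a..c} \<rho>"
  proof -
    have "0 < integral {s..t} \<rho>" if "s < t" "{s..t} \<subseteq> {a..b}" for s t
    proof -
      have c': "continuous_on {s..t} \<rho>" using \<rho>(1) that(2) continuous_on_subset by blast
      have nn: "\<And>x. x \<in> {s..t} \<Longrightarrow> 0 \<le> \<rho> x" using \<rho>(2) that(2) by (meson less_imp_le subsetD)
      have "integral {s..t} \<rho> \<noteq> 0"
        using integral_eq_0_iff[OF c' that(1)] nn \<rho>(2)[of s] that by force
      moreover have "0 \<le> integral {s..t} \<rho>"
        using nn c' by (intro Henstock_Kurzweil_Integration.integral_nonneg integrable_continuous_real)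
      ultimately show ?thesis by simp
    qed
    then show "0 < integral {c..b} \<rho>" "0 < integral {a..c} \<rho>" using c sub by blast+
  qed
  have split: "integral {a..b} k = integral {a..c} k + integral {c..b} k" if "continuous_on {a..b} k" for k :: "real \<Rightarrow> real"
    using c that by (intro Henstock_Kurzweil_Integration.integral_combine[symmetric] integrable_continuous_real) auto
  have q1: "integral {a..c} \<rho> = 1 - q" using split[OF \<rho>(1)] \<rho>(3) by (simp add: q_def)
  define I where "I = integral {a..c} (\<lambda>x. \<rho> x * (f x)\<^sup>2)"
  have 1: "integral {a..b} (\<lambda>x. \<rho> x * (u x)\<^sup>2) = I + (f c)\<^sup>2 * q"
  proof -
    have "integral {a..c} (\<lambda>x. \<rho> x * (u x)\<^sup>2) = I"
      unfolding I_def by (rule integral_cong) (simp add: u_def)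
    moreover have "integral {c..b} (\<lambda>x. \<rho> x * (u x)\<^sup>2) = integral {c..b} (\<lambda>x. \<rho> x * (f c)\<^sup>2)"
      by (rule integral_cong) (auto simp: u_def antisym)
    ultimately show ?thesis
      by (subst split) (auto intro!: continuous_intros \<rho>(1) cu simp: q_def mult.commute)
  qed
  have 2: "integral {a..b} (\<lambda>x. \<rho> x * u x) = f c * q"
  proof -
    have "integral {a..c} (\<lambda>x. \<rho> x * u x) = integral {a..c} (\<lambda>x. \<rho> x * f x)"
      by (rule integral_cong) (simp add: u_def)
    also have "\<dots> = G c - G a"
      using c sub G(1) by (intro integral_by_antiderivative DERIV_subset[OF G(1) sub(1)]) auto
    finally have "integral {a..c} (\<lambda>x. \<rho> x * u x) = 0" using G by simp
    moreover have "integral {c..b} (\<lambda>x. \<rho> x * u x) = integral {c..b} (\<lambda>x. \<rho> x * f c)"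
      by (rule integral_cong) (auto simp: u_def antisym)
    ultimately show ?thesis
      by (subst split) (auto intro!: continuous_intros \<rho>(1) cu simp: q_def mult.commute)
  qed
  \<comment> \<open>On \<open>{a..c}\<close> the energy density
    \<open>C * \<rho> * v\<^sup>2\<close> equals \<open>- G * f'\<close>. Integrating by parts, with
    \<open>G\<close> zero at both ends, turns it into the second moment \<open>I\<close>.\<close>
  have 3: "C * integral {a..b} (\<lambda>x. \<rho> x * (v x)\<^sup>2) = I"
  proof -
    have "integral {c..b} (\<lambda>x. \<rho> x * (v x)\<^sup>2) = integral {c..b} (\<lambda>x. 0)"
      using c G(3) by (intro integral_cong) (auto simp: v_def antisym)
    then have "C * integral {a..b} (\<lambda>x. \<rho> x * (v x)\<^sup>2) = integral {a..c} (\<lambda>x. C * (\<rho> x * (v x)\<^sup>2))"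
      by (subst split) (auto intro!: continuous_intros \<rho>(1) cv)
    also have "\<dots> = integral {a..c} (\<lambda>x. - (G x * (- G x / (C * \<rho> x))))"
    proof (rule integral_cong)
      fix x assume "x \<in> {a..c}"
      then have "0 < \<rho> x" "x \<le> c" using sub \<rho>(2) by auto
      then show "C * (\<rho> x * (v x)\<^sup>2) = - (G x * (- G x / (C * \<rho> x)))"
        using C by (simp add: v_def power2_eq_square field_simps)
    qed
    also have "\<dots> = - integral {a..c} (\<lambda>x. G x * (- G x / (C * \<rho> x)))" by simp
    also have "\<dots> = integral {a..c} (\<lambda>x. \<rho> x * f x * f x)"
    proof -
      have "integral {a..c} (\<lambda>x. \<rho> x * f x * f x) =
          G c * f c - G a * f a - integral {a..c} (\<lambda>x. G x * (- G x / (C * \<rho> x)))"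
        using c sub
        by (intro integral_by_parts_real DERIV_subset[OF G(1) sub(1)] DERIV_subset[OF f sub(1)]
            continuous_on_subset[OF cf' sub(1)] continuous_on_mult
            continuous_on_subset[OF \<rho>(1) sub(1)] continuous_on_subset[OF cf sub(1)]) auto
      then show ?thesis using G by simp
    qed
    finally show ?thesis by (simp add: I_def power2_eq_square mult.assoc)
  qed
  \<comment> \<open>The inequality now reads
    \<open>I + (f c)\<^sup>2 * q - (f c * q)\<^sup>2 \<le> I\<close>, and \<open>I\<close>
    cancels.\<close>
  have "(f c)\<^sup>2 * (q * (1 - q)) \<le> 0"
    using var[OF u cv] unfolding 1 2 3 by (simp add: power2_eq_square algebra_simps)
  moreover have "0 < q * (1 - q)" using qpos q1 by (simp add: q_def)
  ultimately show ?thesis by (smt (verit) mult_pos_pos zero_less_power2)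
qed

section \<open>Monotonicity and a Gronwall estimate on a closed interval\<close>

lemma deriv_within_nonneg_imp_le:
  fixes k k' :: "real \<Rightarrow> real"
  assumes k: "\<And>x. x \<in> {a..b} \<Longrightarrow> (k has_real_derivative k' x) (at x within {a..b})"
    and st: "a \<le> s" "s \<le> t" "t \<le> b" and nn: "\<And>x. s < x \<Longrightarrow> x < t \<Longrightarrow> 0 \<le> k' x"
  shows "k s \<le> k t"
proof (rule DERIV_nonneg_imp_increasing_open[OF st(2)])
  show "continuous_on {s..t} k"
    using k DERIV_continuous_on st by (metis atLeastatMost_subset_iff continuous_on_subset)
  show "\<exists>y. DERIV k x :> y \<and> 0 \<le> y" if "s < x" "x < t" for x
    using k[of x] nn[OF that] that st by (auto simp: at_within_Icc_at)
qed

lemma deriv_within_pos_imp_less: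
  fixes k k' :: "real \<Rightarrow> real"
  assumes k: "\<And>x. x \<in> {a..b} \<Longrightarrow> (k has_real_derivative k' x) (at x within {a..b})"
    and st: "a \<le> s" "s < t" "t \<le> b" and pos: "\<And>x. s < x \<Longrightarrow> x < t \<Longrightarrow> 0 < k' x"
  shows "k s < k t"
proof (rule DERIV_pos_imp_increasing_open[OF st(2)])
  have "{s..t} \<subseteq> {a..b}" using st by auto
  then show "continuous_on {s..t} k"
    using k DERIV_continuous_on continuous_on_subset by metis
  show "\<exists>y. DERIV k x :> y \<and> 0 < y" if "s < x" "x < t" for x
    using k[of x] pos[OF that] that st by (auto simp: at_within_Icc_at)
qed

text \<open>\<open>E x * exp (- L * x)\<close> is nonincreasing and \<open>E x * exp (L * x)\<close>
  is nondecreasing; the first carries the zero at \<open>c\<close> to the right, the second to the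
  left.\<close>

lemma gronwall_zero:
  fixes E E' :: "real \<Rightarrow> real"
  assumes E: "\<And>x. x \<in> {a..b} \<Longrightarrow> (E has_real_derivative E' x) (at x within {a..b})"
    and L: "\<And>x. x \<in> {a..b} \<Longrightarrow> \<bar>E' x\<bar> \<le> L * E x"
    and c: "c \<in> {a..b}" "E c = 0" and x: "x \<in> {a..b}"
  shows "E x \<le> 0"
proof -
  have D: "((\<lambda>x. E x * exp (s * x)) has_real_derivative (E' y + s * E y) * exp (s * y)) (at y within {a..b})"
    if "y \<in> {a..b}" for y s
    by (auto intro!: derivative_eq_intros E that simp: algebra_simps)
  have lin: "- (L * E y) \<le> E' y" "E' y \<le> L * E y" if "y \<in> {a..b}" for y
    using L[OF that] by (auto simp: abs_le_iff)
  show ?thesis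
  proof (cases "c \<le> x")
    case True
    have D': "((\<lambda>x. - (E x * exp (- L * x))) has_real_derivative - ((E' y + (- L) * E y) * exp (- L * y)))
        (at y within {a..b})" if "y \<in> {a..b}" for y
      using DERIV_minus[OF D[OF that, of "- L"]] .
    have "- (E c * exp (- L * c)) \<le> - (E x * exp (- L * x))"
      using c x True lin by (intro deriv_within_nonneg_imp_le[OF D']) (auto simp: mult_le_0_iff)
    then show ?thesis using c by (simp add: mult_le_0_iff)
  next
    case False
    have nn: "0 \<le> (E' y + L * E y) * exp (L * y)" if "y \<in> {a..b}" for y
      using lin(1)[OF that] by (simp add: zero_le_mult_iff)
    have "E x * exp (L * x) \<le> E c * exp (L * c)"
      using c x False by (intro deriv_within_nonneg_imp_le[OF D] nn) auto
    then show ?thesis using c by (simp add: mult_le_0_iff)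
  qed
qed

section \<open>The weight and the comparison of Poincare inequalities\<close>

text \<open>The energy \<open>f\<^sup>2 + G\<^sup>2\<close> has derivative
  \<open>2 * f * G * (p + q)\<close>, hence is controlled by itself, with \<open>L\<close> the
  maximum of \<open>\<bar>p + q\<bar>\<close>.\<close>

lemma linear_ode_unique_zero:
  fixes f G p q :: "real \<Rightarrow> real"
  assumes "a \<le> b" and pq: "continuous_on {a..b} p" "continuous_on {a..b} q"
    and f: "\<And>x. x \<in> {a..b} \<Longrightarrow> (f has_real_derivative p x * G x) (at x within {a..b})"
    and G: "\<And>x. x \<in> {a..b} \<Longrightarrow> (G has_real_derivative q x * f x) (at x within {a..b})"
    and c: "c \<in> {a..b}" "f c = 0" "G c = 0" and x: "x \<in> {a..b}"
  shows "f x = 0"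
proof -
  have "continuous_on {a..b} (\<lambda>x. \<bar>p x + q x\<bar>)" by (intro continuous_intros pq)
  then obtain z where z: "\<And>y. y \<in> {a..b} \<Longrightarrow> \<bar>p y + q y\<bar> \<le> \<bar>p z + q z\<bar>"
    using continuous_attains_sup[OF compact_Icc, of a b] \<open>a \<le> b\<close> by fastforce
  define L where "L = \<bar>p z + q z\<bar>"
  have "(f x)\<^sup>2 + (G x)\<^sup>2 \<le> 0"
  proof (rule gronwall_zero[where c=c and L=L and E="\<lambda>x. (f x)\<^sup>2 + (G x)\<^sup>2" and E'="\<lambda>x. 2 * f x * G x * (p x + q x)"])
    fix y assume y: "y \<in> {a..b}"
    show "((\<lambda>x. (f x)\<^sup>2 + (G x)\<^sup>2) has_real_derivative 2 * f y * G y * (p y + q y)) (at y within {a..b})"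
      by (auto intro!: derivative_eq_intros f[OF y] G[OF y] simp: algebra_simps)
    have "\<bar>2 * f y * G y\<bar> \<le> (f y)\<^sup>2 + (G y)\<^sup>2"
      using sum_squares_bound[of "\<bar>f y\<bar>" "\<bar>G y\<bar>"] by (simp add: abs_mult)
    then have "\<bar>2 * f y * G y\<bar> * \<bar>p y + q y\<bar> \<le> ((f y)\<^sup>2 + (G y)\<^sup>2) * L"
      using z[OF y] by (intro mult_mono) (auto simp: L_def)
    then show "\<bar>2 * f y * G y * (p y + q y)\<bar> \<le> L * ((f y)\<^sup>2 + (G y)\<^sup>2)"
      by (simp add: abs_mult mult.commute)
  qed (use c x in auto)
  then show ?thesis by (simp add: sum_power2_le_zero_iff)
qed

lemma saturates_structure:
  assumes ab: "a < b" and \<mu>: "has_density_on a b \<mu> \<rho>" "prob_space \<mu>"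
    and sat: "saturates a b \<mu> (\<lambda>_. 1) f"
  obtains C G where "0 < C" "poincare_with a b \<mu> (\<lambda>_. 1) C" "G a = 0" "G b = 0"
    "\<And>x. x \<in> {a..b} \<Longrightarrow> (G has_real_derivative \<rho> x * f x) (at x within {a..b})"
    "\<And>x. x \<in> {a..b} \<Longrightarrow> (f has_real_derivative - G x / (C * \<rho> x)) (at x within {a..b})"
    "\<And>x. x \<in> {a<..<b} \<Longrightarrow> G x \<noteq> 0"
proof -
  have cr: "continuous_on {a..b} \<rho>" using has_density_on_continuous[OF \<mu>(1)] .
  have rpos: "0 < \<rho> x" if "x \<in> {a..b}" for x using has_density_on_pos[OF \<mu>(1) that] .
  obtain C G where C: "0 < C" and P: "poincare_with a b \<mu> (\<lambda>_. 1) C" and Gab: "G a = 0" "G b = 0"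
    and G: "\<And>x. x \<in> {a..b} \<Longrightarrow> (G has_real_derivative \<rho> x * f x) (at x within {a..b})"
    and f: "\<And>x. x \<in> {a..b} \<Longrightarrow> (f has_real_derivative - G x / (C * \<rho> x)) (at x within {a..b})"
    using saturates_imp_ode[OF ab \<mu> sat] by metis
  have "G c \<noteq> 0" if c: "c \<in> {a<..<b}" for c
  proof
    assume "G c = 0"
    interpret prob_space \<mu> by (rule \<mu>(2))
    have "integral {a..b} \<rho> = 1"
      using has_density_on_integral_continuous(1)[OF \<mu>(1) continuous_on_const, of 1] by (simp add: prob_space)
    then have "f c = 0"
      using c by (intro ode_zero_imp_value_zero[OF C _ _ cr rpos _ G Gab(1) \<open>G c = 0\<close> f]
          poincare_with_classical[OF ab \<mu> P]) auto
    have cp: "continuous_on {a..b} (\<lambda>x. - 1 / (C * \<rho> x))"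
      using C rpos by (intro continuous_intros cr) force
    have f': "(f has_real_derivative - 1 / (C * \<rho> x) * G x) (at x within {a..b})" if "x \<in> {a..b}" for x
      using f[OF that] by simp
    have "f x = 0" if "x \<in> {a..b}" for x
      using linear_ode_unique_zero[OF less_imp_le[OF ab] cp cr f' G _ \<open>f c = 0\<close> \<open>G c = 0\<close> that] c by auto
    then have "AE x in \<mu>. f x = 0"
      using \<mu>(1) by (intro AE_I2) (auto simp: has_density_on_def space_restrict_space)
    then show False using sat by (simp add: saturates_def)
  qed
  then show thesis using that[OF C P Gab G f] by blast
qed

text \<open>While \<open>g\<close> is negative the primitive falls from 0, and once \<open>g\<close>
  is positive it climbs back to 0. If \<open>g\<close> did not change sign, the two boundary values
  would differ. It serves for \<open>gt\<close> with density \<open>\<tau>\<close> and for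
  \<open>g\<close> with density \<open>\<rho>\<close>.\<close>

lemma increasing_mean_zero_primitive:
  fixes g \<rho> \<Gamma> :: "real \<Rightarrow> real"
  assumes ab: "a < b" and mono: "\<And>x y. a \<le> x \<Longrightarrow> x < y \<Longrightarrow> y \<le> b \<Longrightarrow> g x < g y"
    and \<rho>: "\<And>x. x \<in> {a..b} \<Longrightarrow> 0 < \<rho> x"
    and \<Gamma>: "\<And>x. x \<in> {a..b} \<Longrightarrow> (\<Gamma> has_real_derivative \<rho> x * g x) (at x within {a..b})"
    and 0: "\<Gamma> a = 0" "\<Gamma> b = 0"
  shows "\<And>x. x \<in> {a<..<b} \<Longrightarrow> \<Gamma> x < 0" "g a < 0" "0 < g b"
proof -
  have inc: "\<Gamma> s < \<Gamma> t" if "a \<le> s" "s < t" "t \<le> b" "0 \<le> g s" for s t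
  proof (rule deriv_within_pos_imp_less[OF \<Gamma> that(1-3)])
    fix x assume "s < x" "x < t"
    then show "0 < \<rho> x * g x" using mono[of s x] \<rho>[of x] that by auto
  qed
  have \<Gamma>': "((\<lambda>x. - \<Gamma> x) has_real_derivative - (\<rho> x * g x)) (at x within {a..b})" if "x \<in> {a..b}" for x
    using DERIV_minus[OF \<Gamma>[OF that]] .
  have dec: "\<Gamma> t < \<Gamma> s" if "a \<le> s" "s < t" "t \<le> b" "g t \<le> 0" for s t
  proof -
    have "- \<Gamma> s < - \<Gamma> t"
    proof (rule deriv_within_pos_imp_less[OF \<Gamma>' that(1-3)])
      fix x assume "s < x" "x < t"
      then show "0 < - (\<rho> x * g x)" using mono[of x t] \<rho>[of x] that by (auto simp: mult_pos_neg)
    qed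
    then show ?thesis by simp
  qed
  show "g a < 0" using inc[of a b] 0 ab by force
  show "0 < g b" using dec[of a b] 0 ab by force
  show "\<Gamma> x < 0" if "x \<in> {a<..<b}" for x
    using inc[of x b] dec[of a x] 0 that by (cases "0 \<le> g x") auto
qed

section \<open>Common refinements and the regularity of a quotient of primitives\<close>

lemma piecewise_C1_imp_continuous_on:
  assumes "piecewise_C1 a b f" shows "continuous_on {a..b} f"
proof -
  obtain t :: "nat \<Rightarrow> real" and n where t: "t 0 = a" "t n = b"
    "\<And>i. i < n \<Longrightarrow> t i < t (Suc i)" "\<And>i. i < n \<Longrightarrow> C1_on (t i) (t (Suc i)) f"
    using assms by (auto simp: piecewise_C1_def)
  have "k \<le> n \<Longrightarrow> a \<le> t k \<and> continuous_on {a..t k} f" for k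
  proof (induction k)
    case (Suc k)
    then have "{a..t (Suc k)} = {a..t k} \<union> {t k..t (Suc k)}" using t(3)[of k] by auto
    then show ?case
      using Suc t(3,4)[of k] C1_on_imp_continuous_on[of "t k" "t (Suc k)" f]
      by (auto intro!: continuous_on_closed_Un)
  qed (simp add: t)
  then show ?thesis using t(2) by auto
qed

text \<open>Reduces a piecewise claim to a single piece on which both given functions are
  \<open>C^1\<close>; \<open>T\<close> supplies additional cut points.\<close>

lemma piecewise_C1_common_subdivision:
  assumes "piecewise_C1 a b f" "piecewise_C1 a b g" "finite T"
    and "\<And>c d. a \<le> c \<Longrightarrow> c < d \<Longrightarrow> d \<le> b \<Longrightarrow> {c<..<d} \<inter> T = {} \<Longrightarrow>
      C1_on c d f \<Longrightarrow> C1_on c d g \<Longrightarrow> C1_on c d h"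
  shows "piecewise_C1 a b h"
proof -
  obtain S1 where "finite S1"
    "\<And>c d. a \<le> c \<Longrightarrow> c < d \<Longrightarrow> d \<le> b \<Longrightarrow> {c<..<d} \<inter> S1 = {} \<Longrightarrow> C1_on c d f"
    using assms(1) by (auto simp: piecewise_C1_altdef)
  moreover obtain S2 where "finite S2"
    "\<And>c d. a \<le> c \<Longrightarrow> c < d \<Longrightarrow> d \<le> b \<Longrightarrow> {c<..<d} \<inter> S2 = {} \<Longrightarrow> C1_on c d g"
    using assms(2) by (auto simp: piecewise_C1_altdef)
  moreover have "a \<le> b" using assms(1) by (simp add: piecewise_C1_altdef)
  ultimately show ?thesis
    using assms(3,4) unfolding piecewise_C1_altdef
    by (intro conjI exI[of _ "S1 \<union> S2 \<union> T"]) (auto simp: Int_Un_distrib)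
qed

lemma piecewise_C1_cong:
  assumes "\<And>x. x \<in> {a..b} \<Longrightarrow> f x = g x" "piecewise_C1 a b f"
  shows "piecewise_C1 a b g"
proof (rule piecewise_C1_common_subdivision[OF assms(2,2) finite.emptyI])
  fix c d assume cd: "a \<le> c" "c < d" "d \<le> b" "C1_on c d f"
  show "C1_on c d g"
    by (rule C1_on_cong[OF cd(2) _ cd(4)]) (use assms(1) cd in auto)
qed

text \<open>Near an endpoint \<open>e\<close>, the quotient is a quotient of the two difference quotients at \<open>e\<close>.\<close>

lemma piecewise_C1_primitive_quotient:
  fixes \<rho> \<tau> f g \<Gamma> G :: "real \<Rightarrow> real"
  assumes ab: "a < b" and pc: "piecewise_C1 a b \<rho>" "piecewise_C1 a b \<tau>"
    and fg: "C1_on a b f" "C1_on a b g"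
    and \<Gamma>: "\<And>x. x \<in> {a..b} \<Longrightarrow> (\<Gamma> has_real_derivative \<rho> x * g x) (at x within {a..b})"
    and G: "\<And>x. x \<in> {a..b} \<Longrightarrow> (G has_real_derivative \<tau> x * f x) (at x within {a..b})"
    and 0: "\<Gamma> a = 0" "\<Gamma> b = 0" "G a = 0" "G b = 0"
    and nz: "\<And>x. x \<in> {a<..<b} \<Longrightarrow> G x \<noteq> 0" "\<tau> a * f a \<noteq> 0" "\<tau> b * f b \<noteq> 0"
  defines "R \<equiv> \<lambda>x. if x = a \<or> x = b then \<rho> x * g x / (\<tau> x * f x) else \<Gamma> x / G x"
  shows "piecewise_C1 a b R"
proof (rule piecewise_C1_common_subdivision[OF pc])
  \<comment> \<open>Cutting at the midpoint keeps \<open>a\<close> and \<open>b\<close> in different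
    pieces, so that each piece has at most one endpoint where the quotient degenerates.\<close>
  show "finite {(a + b) / 2}" by simp
next
  fix c d assume cd: "a \<le> c" "c < d" "d \<le> b" "{c<..<d} \<inter> {(a + b) / 2} = {}"
    and C1: "C1_on c d \<rho>" "C1_on c d \<tau>"
  have sub: "{c..d} \<subseteq> {a..b}" using cd by auto
  have C1p: "C1_on c d (\<lambda>x. \<rho> x * g x)" "C1_on c d (\<lambda>x. \<tau> x * f x)"
    using C1 fg cd by (auto intro!: C1_on_mult C1_on_subset[of a b])
  have \<Gamma>': "(\<Gamma> has_real_derivative \<rho> x * g x) (at x within {c..d})"
    and G': "(G has_real_derivative \<tau> x * f x) (at x within {c..d})" if "x \<in> {c..d}" for x
    using \<Gamma> G sub that DERIV_subset by blast+
  have not_both: "\<not> (c = a \<and> d = b)" using cd ab by auto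
  show "C1_on c d R"
  proof (cases "c = a \<or> d = b")
    case True
    then obtain e where e: "e \<in> {c..d}" "e = a \<or> e = b" "\<And>x. x \<in> {c..d} \<Longrightarrow> x \<noteq> e \<Longrightarrow> x \<in> {a<..<b}"
    proof (cases "c = a")
      case True
      then show ?thesis using that[of a] cd not_both by auto
    next
      case False
      then show ?thesis using \<open>c = a \<or> d = b\<close> that[of b] cd not_both by auto
    qed
    have e0: "\<Gamma> e = 0" "G e = 0" "\<tau> e * f e \<noteq> 0" using e(2) 0 nz(2,3) by auto
    have "C1_on c d (\<lambda>x. (if x = e then \<rho> e * g e else \<Gamma> x / (x - e)) /
        (if x = e then \<tau> e * f e else G x / (x - e)))"
      using e nz(1) e0
      by (intro C1_on_divide cd(2) C1_on_difference_quotient[OF _ e(1) _ C1p(1) \<Gamma>']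
          C1_on_difference_quotient[OF _ e(1) _ C1p(2) G']) auto
    then show ?thesis
      by (rule C1_on_cong[OF cd(2), rotated]) (use e(2,3) in \<open>force simp: R_def\<close>)
  next
    case False
    then have *: "x \<in> {a<..<b}" if "x \<in> {c..d}" for x using that cd by auto
    have "C1_on c d \<Gamma>" by (rule C1_onI[OF cd(2) \<Gamma>' C1_on_imp_continuous_on[OF C1p(1)]])
    moreover have "C1_on c d G" by (rule C1_onI[OF cd(2) G' C1_on_imp_continuous_on[OF C1p(2)]])
    ultimately have "C1_on c d (\<lambda>x. \<Gamma> x / G x)"
      using * nz(1) by (intro C1_on_divide cd(2)) auto
    then show ?thesis
      by (rule C1_on_cong[OF cd(2), rotated]) (use * in \<open>force simp: R_def\<close>)
  qed
qed

text \<open>A function with \<open>\<mu>\<close>-mean zero has its smallest second moment under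
  \<open>\<mu>\<close> when left uncentred, so recentring it by its \<open>\<nu>\<close>-mean only
  enlarges the left side. The density bounds then lead to \<open>\<nu>\<close>, and the minimum of
  \<open>w\<close> brings the weight back.\<close>

lemma weighted_poincare_comparison:
  assumes ab: "a < b" and \<mu>: "has_density_on a b \<mu> \<rho>" "prob_space \<mu>"
    and \<nu>: "has_density_on a b \<nu> \<tau>" "prob_space \<nu>"
    and P: "poincare_with a b \<nu> (\<lambda>_. 1) C"
    and w: "continuous_on {a..b} w" "\<And>x. x \<in> {a..b} \<Longrightarrow> 0 < w x"
  shows "weighted_poincare a b \<mu> w"
proof -
  let ?L = "restrict_space lborel {a..b}"
  interpret M: prob_space \<mu> by (rule \<mu>(2))
  interpret N: prob_space \<nu> by (rule \<nu>(2))
  have sp: "space ?L = {a..b}" by (simp add: space_restrict_space)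
  have C: "0 < C" using P by (simp add: poincare_with_def)
  obtain r R where r: "0 < r" "\<And>x. x \<in> {a..b} \<Longrightarrow> r \<le> \<rho> x" "\<And>x. x \<in> {a..b} \<Longrightarrow> \<rho> x \<le> R"
    using has_density_on_bounds[OF ab \<mu>(1)] by metis
  obtain s S where s: "0 < s" "\<And>x. x \<in> {a..b} \<Longrightarrow> s \<le> \<tau> x" "\<And>x. x \<in> {a..b} \<Longrightarrow> \<tau> x \<le> S"
    using has_density_on_bounds[OF ab \<nu>(1)] by metis
  have RS: "0 < R" "0 < S" using r(1) r(2,3)[of a] s(1) s(2,3)[of a] ab by auto
  obtain z where z: "z \<in> {a..b}" "\<And>y. y \<in> {a..b} \<Longrightarrow> w z \<le> w y"
    using continuous_attains_inf[OF compact_Icc _ w(1)] ab by auto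
  obtain y where y: "y \<in> {a..b}" "\<And>x. x \<in> {a..b} \<Longrightarrow> w x \<le> w y"
    using continuous_attains_sup[OF compact_Icc _ w(1)] ab by auto
  have wz: "0 < w z" using w(2) z(1) by blast
  have wm: "w \<in> borel_measurable ?L" using continuous_on_measurable_Icc[OF w(1)] .
  \<comment> \<open>\<open>R / s\<close> passes the second moment from \<open>\<mu>\<close> to
    \<open>\<nu>\<close>, \<open>C\<close> is the inequality for \<open>\<nu>\<close>,
    \<open>S\<close> returns to Lebesgue measure, and \<open>r * w z\<close> bounds the weighted
    density from below.\<close>
  define K where "K = R / s * C * S / (r * w z)"
  have "poincare_with a b \<mu> w K"
    unfolding poincare_with_def
  proof (intro conjI ballI allI impI)
    show "0 < K" using RS C r(1) s(1) wz by (simp add: K_def)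
    fix f h assume fH: "f \<in> H1 a b \<mu> w" and "weak_deriv a b f h \<and> (\<integral>x. f x \<partial>\<mu>) = 0"
    then have h: "weak_deriv a b f h" and f0: "(\<integral>x. f x \<partial>\<mu>) = 0" by auto
    have fm: "f \<in> borel_measurable ?L" and hm: "h \<in> borel_measurable ?L"
      using weak_deriv_measurable[OF ab h] by auto
    \<comment> \<open>\<open>h0\<close> certifies membership of the recentred function in
      \<open>H1\<close> for \<open>\<nu>\<close>; the arbitrary weak derivative \<open>h\<close> is
      the one for which that inequality is then used.\<close>
    obtain h0 where h0: "weak_deriv a b f h0" "(\<lambda>x. sqrt (w x) * h0 x) \<in> L2 \<mu>" and fL: "f \<in> L2 \<mu>"
      using fH by (auto simp: H1_def)
    have h0m: "h0 \<in> borel_measurable ?L" using weak_deriv_measurable[OF ab h0(1)] by auto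
    have fN: "f \<in> L2 \<nu>" using fL L2_iff_lebesgue[OF \<mu>(1) r] L2_iff_lebesgue[OF \<nu>(1) s] by blast
    have "(\<lambda>x. sqrt (w x) * h0 x) \<in> L2 ?L" using h0(2) L2_iff_lebesgue[OF \<mu>(1) r] by blast
    then have "integrable ?L (\<lambda>x. (sqrt (w x) * h0 x)\<^sup>2)" by (simp add: L2_def)
    then have "integrable ?L (\<lambda>x. w z * (h0 x)\<^sup>2)"
    proof (rule Bochner_Integration.integrable_bound)
      show "AE x in ?L. norm (w z * (h0 x)\<^sup>2) \<le> norm ((sqrt (w x) * h0 x)\<^sup>2)"
        using z w(2) wz by (intro AE_I2) (auto simp: sp power_mult_distrib abs_mult less_imp_le intro!: mult_right_mono)
    qed (use h0m in measurable)
    then have "h0 \<in> L2 ?L" using h0m wz by (simp add: L2_def)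
    then have h0N: "h0 \<in> L2 \<nu>" using L2_iff_lebesgue[OF \<nu>(1) s] by blast
    have c1: "(\<lambda>_. 1) \<in> L2 \<mu>" "(\<lambda>_. 1) \<in> L2 \<nu>" by (simp_all add: L2_def)
    define m where "m = (\<integral>x. f x \<partial>\<nu>)"
    define k where "k x = f x + (- m) * 1" for x
    have kL: "k \<in> L2 \<nu>" unfolding k_def by (rule L2_add_mult(1)[OF fN c1(2)])
    have km: "k \<in> borel_measurable ?L" unfolding k_def using fm by measurable
    have kd: "weak_deriv a b k h" "weak_deriv a b k h0"
      unfolding k_def using weak_deriv_add_mult[OF h weak_deriv_const[OF ab], of "-m" 1]
        weak_deriv_add_mult[OF h0(1) weak_deriv_const[OF ab], of "-m" 1] by simp_all
    have "k \<in> H1 a b \<nu> (\<lambda>_. 1)" using kL kd(2) h0N by (auto simp: H1_def)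
    moreover have "(\<integral>x. k x \<partial>\<nu>) = 0"
      using L2_mult_integrable[OF fN c1(2)] unfolding k_def by (simp add: m_def N.prob_space)
    ultimately have Pk: "(\<integral>x. (k x)\<^sup>2 \<partial>\<nu>) \<le> C * (\<integral>x. (h x)\<^sup>2 \<partial>\<nu>)"
      using P kd(1) by (auto simp: poincare_with_def)
    have "(\<integral>x. (k x)\<^sup>2 \<partial>\<mu>) = (\<integral>x. (f x)\<^sup>2 \<partial>\<mu>) + m\<^sup>2"
      unfolding k_def L2_add_mult(2)[OF fL c1(1)] using f0 by (simp add: M.prob_space)
    then have "(\<integral>x. (f x)\<^sup>2 \<partial>\<mu>) \<le> (\<integral>x. (k x)\<^sup>2 \<partial>\<mu>)" by simp
    also have "\<dots> \<le> R * (\<integral>x. (k x)\<^sup>2 \<partial>?L)"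
      using km by (intro has_density_on_compare(3)[OF \<mu>(1) _ _ r]) auto
    also have "\<dots> = R / s * (s * (\<integral>x. (k x)\<^sup>2 \<partial>?L))" using s(1) by simp
    also have "\<dots> \<le> R / s * (\<integral>x. (k x)\<^sup>2 \<partial>\<nu>)"
      using km RS s(1) by (intro mult_left_mono has_density_on_compare(2)[OF \<nu>(1) _ _ s]) auto
    also have "\<dots> \<le> R / s * (C * (\<integral>x. (h x)\<^sup>2 \<partial>\<nu>))"
      using Pk RS s(1) by (intro mult_left_mono) auto
    also have "\<dots> \<le> R / s * (C * (S * (\<integral>x. (h x)\<^sup>2 \<partial>?L)))"
      using hm RS s(1) C by (intro mult_left_mono has_density_on_compare(3)[OF \<nu>(1) _ _ s]) auto
    also have "\<dots> = K * (r * (\<integral>x. w z * (h x)\<^sup>2 \<partial>?L))"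
      using r(1) wz by (simp add: K_def field_simps)
    also have "\<dots> \<le> K * (\<integral>x. w x * (h x)\<^sup>2 \<partial>\<mu>)"
    proof (rule mult_left_mono)
      show "0 \<le> K" using \<open>0 < K\<close> by simp
      show "r * (\<integral>x. w z * (h x)\<^sup>2 \<partial>?L) \<le> (\<integral>x. w x * (h x)\<^sup>2 \<partial>\<mu>)"
      \<comment> \<open>Without integrability the left side is the Bochner default 0. With it, the
        maximum \<open>w y\<close> makes the right side integrable, as the monotonicity of the
        integral requires.\<close>
      proof (cases "integrable ?L (\<lambda>x. w z * (h x)\<^sup>2)")
        case i: True
        then have "integrable ?L (\<lambda>x. w y * (h x)\<^sup>2)" using wz by simp
        then have True: "integrable ?L (\<lambda>x. w x * (h x)\<^sup>2)"
        proof (rule Bochner_Integration.integrable_bound)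
          show "AE x in ?L. norm (w x * (h x)\<^sup>2) \<le> norm (w y * (h x)\<^sup>2)"
            using y w(2) by (intro AE_I2) (force simp: sp abs_mult less_imp_le intro!: mult_right_mono)
        qed (use hm wm in measurable)
        have "r * (\<integral>x. w z * (h x)\<^sup>2 \<partial>?L) \<le> r * (\<integral>x. w x * (h x)\<^sup>2 \<partial>?L)"
          using r(1) z(2) by (intro mult_left_mono integral_mono[OF i True]) (auto simp: sp intro!: mult_right_mono)
        also have "\<dots> \<le> (\<integral>x. w x * (h x)\<^sup>2 \<partial>\<mu>)"
          using hm wm w(2) by (intro has_density_on_compare(2)[OF \<mu>(1) _ _ r]) (auto simp: less_imp_le)
        finally show ?thesis .
      next
        case False
        have "0 \<le> (\<integral>x. w x * (h x)\<^sup>2 \<partial>\<mu>)"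
          using w(2) \<mu>(1)
          by (intro Bochner_Integration.integral_nonneg_AE AE_I2)
            (auto simp: has_density_on_def sp less_imp_le)
        with False show ?thesis by (simp add: not_integrable_integral_eq)
      qed
    qed
    finally show "(\<integral>x. (f x)\<^sup>2 \<partial>\<mu>) \<le> K * (\<integral>x. w x * (h x)\<^sup>2 \<partial>\<mu>)" .
  qed
  then show ?thesis by (auto simp: weighted_poincare_def)
qed

text \<open>As \<open>G e = 0\<close>, the difference quotient of the product is that of
  \<open>G\<close> times \<open>q\<close>, so continuity of \<open>q\<close> suffices. This gives
  the second derivative of \<open>g\<close> at the endpoints, with
  \<open>q = - 1 / (C \<tau>)\<close>.\<close>

lemma has_real_derivative_mult_zero:
  fixes G q :: "real \<Rightarrow> real"
  assumes "(G has_real_derivative D) (at e within S)" "G e = 0" "continuous (at e within S) q"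
  shows "((\<lambda>x. G x * q x) has_real_derivative D * q e) (at e within S)"
proof -
  have "((\<lambda>x. (G x - G e) / (x - e) * q x) \<longlongrightarrow> D * q e) (at e within S)"
    using assms by (intro tendsto_mult) (auto simp: has_field_derivative_iff continuous_within)
  then show ?thesis using assms(2) by (simp add: has_field_derivative_iff)
qed

text \<open>One-sided limits are unique, so the endpoint values that \<open>Lim\<close> selects are
  those of any continuous extension of the interior formula.\<close>

lemma weight_of_eq:
  assumes ab: "a < b" and W: "continuous_on {a..b} W"
    and eq: "\<And>x. x \<in> {a<..<b} \<Longrightarrow> weight_interior a b \<rho> g x = W x"
    and x: "x \<in> {a..b}"
  shows "weight_of a b \<rho> g x = W x"
proof -
  have "\<forall>\<^sub>F x in at_right a. W x = weight_interior a b \<rho> g x"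
    using eventually_at_right_real[OF ab] by eventually_elim (simp add: eq)
  then have 1: "(weight_interior a b \<rho> g \<longlongrightarrow> W a) (at_right a)"
    using continuous_on_Icc_at_rightD[OF W ab] by (rule Lim_transform_eventually[rotated])
  have "\<forall>\<^sub>F x in at_left b. W x = weight_interior a b \<rho> g x"
    using eventually_at_left_real[OF ab] by eventually_elim (simp add: eq)
  then have 2: "(weight_interior a b \<rho> g \<longlongrightarrow> W b) (at_left b)"
    using continuous_on_Icc_at_leftD[OF W ab] by (rule Lim_transform_eventually[rotated])
  show ?thesis
    using x ab eq[of x] tendsto_Lim[OF _ 1] tendsto_Lim[OF _ 2]
    by (cases "x = a"; cases "x = b") (auto simp: weight_of_def)
qed

theorem proposition3p1:
  fixes a b :: real
    and \<mu> \<mu>t :: "real measure"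
    and \<rho> gt g :: "real \<Rightarrow> real"
  assumes "a < b"
    and "\<mu> \<in> prob_class a b"
    and "\<mu>t \<in> prob_class a b"
    and "has_density_on a b \<mu> \<rho>"
    and "saturates a b \<mu>t (\<lambda>_. 1) gt"
    and "g = (\<lambda>x. gt x - (\<integral>y. gt y \<partial>\<mu>))"
  shows "g \<in> C12_star a b \<and>
    deriv_on a b g a = 0 \<and> deriv_on a b g b = 0 \<and>
    deriv_on a b (deriv_on a b g) a \<noteq> 0 \<and> deriv_on a b (deriv_on a b g) b \<noteq> 0 \<and>
    weight_of a b \<rho> g \<in> weights a b \<and>
    (\<forall>x\<in>{a..b}. weight_of a b \<rho> g x \<noteq> 0) \<and>
    weighted_poincare a b \<mu> (weight_of a b \<rho> g)"
proof -
  note ab = assms(1) and \<mu>d = assms(4)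
  have \<mu>p: "prob_space \<mu>" and \<mu>tp: "prob_space \<mu>t" using assms by (auto simp: prob_class_def)
  interpret prob_space \<mu> by (rule \<mu>p)
  obtain \<tau> where \<mu>td: "has_density_on a b \<mu>t \<tau>" using assms(3) by (auto simp: prob_class_def)
  have c\<rho>: "continuous_on {a..b} \<rho>" and c\<tau>: "continuous_on {a..b} \<tau>"
    using has_density_on_continuous \<mu>d \<mu>td by auto
  have pc: "piecewise_C1 a b \<rho>" "piecewise_C1 a b \<tau>"
    using \<mu>d \<mu>td by (auto simp: has_density_on_def C01_plus_def)
  have \<rho>pos: "0 < \<rho> x" and \<tau>pos: "0 < \<tau> x" if "x \<in> {a..b}" for x
    using has_density_on_pos \<mu>d \<mu>td that by auto
  obtain C G where C: "0 < C" and P: "poincare_with a b \<mu>t (\<lambda>_. 1) C" and G0: "G a = 0" "G b = 0"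
    and G: "\<And>x. x \<in> {a..b} \<Longrightarrow> (G has_real_derivative \<tau> x * gt x) (at x within {a..b})"
    and f: "\<And>x. x \<in> {a..b} \<Longrightarrow> (gt has_real_derivative - G x / (C * \<tau> x)) (at x within {a..b})"
    and Gnz: "\<And>x. x \<in> {a<..<b} \<Longrightarrow> G x \<noteq> 0"
    using saturates_structure[OF ab \<mu>td \<mu>tp assms(5)] by metis
  have cG: "continuous_on {a..b} G" by (rule DERIV_continuous_on[OF G])
  have cf: "continuous_on {a..b} gt" by (rule DERIV_continuous_on[OF f])
  have g: "(g has_real_derivative - G x / (C * \<tau> x)) (at x within {a..b})" if "x \<in> {a..b}" for x
    unfolding assms(6) using DERIV_diff[OF f[OF that] DERIV_const] by simp
  have cg: "continuous_on {a..b} g" by (rule DERIV_continuous_on[OF g])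
  have cf': "continuous_on {a..b} (\<lambda>x. - G x / (C * \<tau> x))"
    using C \<tau>pos by (intro continuous_intros cG c\<tau>) force

  \<comment> \<open>\<open>G\<close> keeps one sign by the intermediate value theorem. The factor
    \<open>\<sigma>\<close> makes both \<open>gt\<close> and \<open>g\<close> increasing, which
    covers the two cases of \<open>C12_star\<close> at once.\<close>
  obtain \<sigma> :: real where \<sigma>: "\<sigma> = 1 \<or> \<sigma> = -1" "\<And>x. x \<in> {a<..<b} \<Longrightarrow> \<sigma> * G x < 0"
  proof -
    have "(\<forall>x\<in>{a<..<b}. G x < 0) \<or> (\<forall>x\<in>{a<..<b}. 0 < G x)"
    proof (rule ccontr)
      assume "\<not> ?thesis"
      then obtain s t where st: "s \<in> {a<..<b}" "t \<in> {a<..<b}" "G s \<le> 0" "0 \<le> G t"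
        by (meson not_less)
      have "connected (G ` {a<..<b})"
        by (intro connected_continuous_image continuous_on_subset[OF cG]) auto
      then have "0 \<in> G ` {a<..<b}"
        using connectedD_interval[of "G ` {a<..<b}" "G s" "G t" 0] st by blast
      then show False using Gnz by auto
    qed
    then show thesis using that[of 1] that[of "-1"] by auto
  qed
  have g'pos: "0 < \<sigma> * (- G x / (C * \<tau> x))" if "x \<in> {a<..<b}" for x
    using \<sigma>(2)[OF that] C \<tau>pos[of x] that by (auto simp: field_simps)
  have mono: "\<sigma> * gt x < \<sigma> * gt y" "\<sigma> * g x < \<sigma> * g y" if "a \<le> x" "x < y" "y \<le> b" for x y
  proof -
    show "\<sigma> * gt x < \<sigma> * gt y"
      by (rule deriv_within_pos_imp_less[OF DERIV_cmult[OF f] that]) (use that g'pos in auto)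
    then show "\<sigma> * g x < \<sigma> * g y" by (simp add: assms(6) right_diff_distrib)
  qed

  define \<Gamma> where "\<Gamma> x = integral {a..x} (\<lambda>y. \<rho> y * g y)" for x
  have c\<rho>g: "continuous_on {a..b} (\<lambda>y. \<rho> y * g y)" by (intro continuous_intros c\<rho> cg)
  have \<Gamma>: "(\<Gamma> has_real_derivative \<rho> x * g x) (at x within {a..b})" if "x \<in> {a..b}" for x
    unfolding \<Gamma>_def has_real_derivative_iff_has_vector_derivative
    by (rule integral_has_vector_derivative[OF c\<rho>g that])
  have "\<Gamma> b = (\<integral>x. g x \<partial>\<mu>)"
    unfolding \<Gamma>_def by (rule has_density_on_integral_continuous(1)[OF \<mu>d cg, symmetric])
  also have "\<dots> = 0"
    unfolding assms(6) using has_density_on_integral_continuous(2)[OF \<mu>d cf] by (simp add: prob_space)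
  finally have \<Gamma>0: "\<Gamma> a = 0" "\<Gamma> b = 0" by (simp_all add: \<Gamma>_def)

  have G\<sigma>: "((\<lambda>x. \<sigma> * G x) has_real_derivative \<tau> x * (\<sigma> * gt x)) (at x within {a..b})"
    and \<Gamma>\<sigma>: "((\<lambda>x. \<sigma> * \<Gamma> x) has_real_derivative \<rho> x * (\<sigma> * g x)) (at x within {a..b})"
    if "x \<in> {a..b}" for x
    using DERIV_cmult[OF G[OF that], of \<sigma>] DERIV_cmult[OF \<Gamma>[OF that], of \<sigma>] by (simp_all add: mult.left_commute)
  have fab: "\<sigma> * gt a < 0" "0 < \<sigma> * gt b"
    using increasing_mean_zero_primitive(2,3)[OF ab mono(1) \<tau>pos G\<sigma>] G0 by auto
  have gab: "\<sigma> * g a < 0" "0 < \<sigma> * g b"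
    and \<Gamma>neg: "\<And>x. x \<in> {a<..<b} \<Longrightarrow> \<sigma> * \<Gamma> x < 0"
    using increasing_mean_zero_primitive[OF ab mono(2) \<rho>pos \<Gamma>\<sigma>] \<Gamma>0 by auto

  have dg: "deriv_on a b g x = - G x / (C * \<tau> x)" if "x \<in> {a..b}" for x
    by (rule deriv_on_eq[OF ab that g[OF that]])
  have "(\<lambda>x. \<sigma> * deriv_on a b g x) \<in> C01_plus a b"
  proof -
    have "piecewise_C1 a b (\<lambda>x. (- \<sigma> * G x) / (C * \<tau> x))"
    proof (rule piecewise_C1_common_subdivision[OF pc(2,2) finite.emptyI])
      fix c d assume cd: "a \<le> c" "c < d" "d \<le> b" "C1_on c d \<tau>"
      have "C1_on a b G"
        by (rule C1_onI[OF ab G]) (auto intro!: continuous_intros c\<tau> cf)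
      then have "C1_on c d G" using cd(1-3) by (rule C1_on_subset)
      then show "C1_on c d (\<lambda>x. (- \<sigma> * G x) / (C * \<tau> x))"
        using cd C \<tau>pos[THEN less_imp_neq] by (intro C1_on_divide C1_on_mult C1_on_const) auto
    qed
    then have pw: "piecewise_C1 a b (\<lambda>x. \<sigma> * deriv_on a b g x)"
      by (rule piecewise_C1_cong[rotated]) (simp add: dg)
    then show ?thesis
      using piecewise_C1_imp_continuous_on[OF pw] g'pos by (auto simp: C01_plus_def dg)
  qed
  moreover have "g differentiable_on {a..b}"
    using g by (meson differentiable_on_def real_differentiable_def)
  ultimately have star: "g \<in> C12_star a b" using \<sigma>(1) by (auto simp: C12_star_def)

  have d0: "deriv_on a b g a = 0" "deriv_on a b g b = 0" using dg[of a] dg[of b] G0 ab by auto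
  \<comment> \<open>The density cancels and the value is \<open>- gt e / C\<close>.\<close>
  have dd: "deriv_on a b (deriv_on a b g) e \<noteq> 0" if e: "e = a \<or> e = b" for e
  proof -
    have e': "e \<in> {a..b}" "G e = 0" "gt e \<noteq> 0" using e ab G0 fab by auto
    have "continuous_on {a..b} (\<lambda>x. - 1 / (C * \<tau> x))"
      using C \<tau>pos by (intro continuous_intros c\<tau>) force
    then have "((\<lambda>x. G x * (- 1 / (C * \<tau> x))) has_real_derivative \<tau> e * gt e * (- 1 / (C * \<tau> e)))
        (at e within {a..b})"
      using e' by (intro has_real_derivative_mult_zero[OF G]) (auto simp: continuous_on_eq_continuous_within)
    then have "(deriv_on a b g has_real_derivative \<tau> e * gt e * (- 1 / (C * \<tau> e))) (at e within {a..b})"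
      by (rule has_field_derivative_transform_within[OF _ zero_less_one e'(1)]) (simp add: dg)
    from deriv_on_eq[OF ab e'(1) this] show ?thesis using C \<tau>pos[OF e'(1)] e'(3) by simp
  qed

  \<comment> \<open>The endpoint values are those of l'Hopital's rule, as
    \<open>\<Gamma>' = \<rho> g\<close> and \<open>G' = \<tau> gt\<close>.\<close>
  define R where "R = (\<lambda>x. if x = a \<or> x = b then \<rho> x * g x / (\<tau> x * gt x) else \<Gamma> x / G x)"
  define W where "W x = C * \<tau> x / \<rho> x * R x" for x
  have C1f: "C1_on a b gt" and C1g: "C1_on a b g"
    by (rule C1_onI[OF ab f cf'], assumption) (rule C1_onI[OF ab g cf'])
  have pR: "piecewise_C1 a b R"
    unfolding R_def using fab \<tau>pos[of a] \<tau>pos[of b] ab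
    by (intro piecewise_C1_primitive_quotient[OF ab pc C1f C1g \<Gamma> G \<Gamma>0 G0 Gnz]) auto
  have pW: "piecewise_C1 a b W"
  proof (rule piecewise_C1_common_subdivision[OF pR _ finite.emptyI])
    show "piecewise_C1 a b (\<lambda>x. C * \<tau> x / \<rho> x)"
    proof (rule piecewise_C1_common_subdivision[OF pc finite.emptyI])
      fix c d assume cd: "a \<le> c" "c < d" "d \<le> b" "C1_on c d \<rho>" "C1_on c d \<tau>"
      then show "C1_on c d (\<lambda>x. C * \<tau> x / \<rho> x)"
        using \<rho>pos[THEN less_imp_neq] by (intro C1_on_divide C1_on_mult C1_on_const) auto
    qed
    fix c d assume "c < d" "C1_on c d R" "C1_on c d (\<lambda>x. C * \<tau> x / \<rho> x)"
    then show "C1_on c d W" unfolding W_def by (intro C1_on_mult)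
  qed
  have cW: "continuous_on {a..b} W" by (rule piecewise_C1_imp_continuous_on[OF pW])
  have Wpos: "0 < W x" if x: "x \<in> {a..b}" for x
  proof -
    have "0 < R x"
    proof (cases "x = a \<or> x = b")
      case True
      \<comment> \<open>\<open>g\<close> and \<open>gt\<close> have the same sign at each endpoint,
        both being increasing with mean zero after multiplication by
        \<open>\<sigma>\<close>.\<close>
      have "0 < g x / gt x" using True fab gab \<sigma>(1) by (auto simp: zero_less_divide_iff)
      moreover have "0 < \<rho> x / \<tau> x" using \<rho>pos[OF x] \<tau>pos[OF x] by simp
      ultimately have "0 < \<rho> x / \<tau> x * (g x / gt x)" by (rule mult_pos_pos[rotated])
      then show ?thesis using True by (simp add: R_def)
    next
      case False
      then have x': "x \<in> {a<..<b}" using x by auto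
      then have "0 < \<Gamma> x / G x"
        using \<Gamma>neg[OF x'] \<sigma>(2)[OF x'] \<sigma>(1) by (auto simp: zero_less_divide_iff)
      then show ?thesis using False by (simp add: R_def)
    qed
    then show ?thesis using C \<rho>pos[OF x] \<tau>pos[OF x] by (simp add: W_def)
  qed
  have "weight_interior a b \<rho> g x = W x" if x: "x \<in> {a<..<b}" for x
  proof -
    have x': "x \<in> {a..b}" "x \<noteq> a" "x \<noteq> b" using x by auto
    have "(LINT y:{a..x}|lborel. g y * \<rho> y) = integral {a..x} (\<lambda>y. g y * \<rho> y)"
      using x by (intro set_integral_Icc_continuous continuous_intros continuous_on_subset[OF cg]
          continuous_on_subset[OF c\<rho>]) auto
    also have "\<dots> = \<Gamma> x" by (simp add: \<Gamma>_def mult.commute)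
    finally show ?thesis
      unfolding weight_interior_def dg[OF x'(1)] using C \<rho>pos[OF x'(1)] \<tau>pos[OF x'(1)] Gnz[OF x] x'
      by (simp add: W_def R_def field_simps)
  qed
  then have w: "weight_of a b \<rho> g x = W x" if "x \<in> {a..b}" for x
    using weight_of_eq[OF ab cW] that by blast
  have pw: "piecewise_C1 a b (weight_of a b \<rho> g)"
    by (rule piecewise_C1_cong[OF _ pW]) (simp add: w)
  have cw: "continuous_on {a..b} (weight_of a b \<rho> g)" by (rule piecewise_C1_imp_continuous_on[OF pw])
  have wpos: "0 < weight_of a b \<rho> g x" if "x \<in> {a..b}" for x using w[OF that] Wpos[OF that] by simp
  have "weight_of a b \<rho> g \<in> weights a b" using pw cw wpos by (auto simp: weights_def)
  moreover have "weighted_poincare a b \<mu> (weight_of a b \<rho> g)"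
    by (rule weighted_poincare_comparison[OF ab \<mu>d \<mu>p \<mu>td \<mu>tp P cw wpos])
  ultimately show ?thesis using star d0 dd wpos by fastforce
qed

end
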